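(* Let $n,k$ be positive integers. Each tree $T$ with order $n$ and maximum degree $k$ satisfies $$d(Core(T),CT(T))\le n-n'-\left\lceil\frac{n+1}{2}\right\rceil+1,$$ where $n'$ is the minimum order of an extended rgood tree $T_u$ with maximum degree $k$ and root $u$ such that $F_{T_u}(u)\ge n-|V(T_u)|$. This inequality is tight for the tree (of order $n$) formed by identifying the root of the extended rgood tree with one end of a path of appropriate length.
   Context: For vertices $u,v$ of a tree $T$, $d(u,v)$ is the number of edges on the unique path joining them. The distance of $v$ is $d_T(v)=\sum_{u\in V(T)}d(v,u)$, and the centroid $CT(T)$ is the set of vertices minimizing $d_T$. A subtree of $T$ is a connected subgraph induced on a nonempty set of vertices; $F_T(v)$ is the number of subtrees of $T$ containing $v$, and the subtree core $Core(T)$ is the set of vertices maximizing $F_T$. For vertex sets $S,S'$, $d(S,S')=\min\{d(u,v):u\in S,\ v\in S'\}$. Rooted greedy tree: given a tree degree sequence in non-increasing order with one entry distinguished as the root degree, let $d'_1\ge d'_2\ge\dots$ be the sequence with that entry removed. The rooted greedy tree has a root of the distinguished degree; the children of the root receive, from left to right, the degrees $d'_1,d'_2,\dots$; then, level by level, the vertices of a level are processed from left to right, each non-root vertex of degree $d$ being joined to the next $d-1$ vertices of the following level, and the vertices of the following level receive, from left to right, the next largest unused entries in non-increasing order. Extended rgood tree with order $m$ and maximum degree $k$: the rooted greedy tree on $m$ vertices with root degree $k-1$ and degree sequence $(k,k,\dots,k,k-1,s,1,\dots,1)$ for some $1\le s<k$.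
   Formalization: The right side is replaced by its maximum with 0, since it can be negative (star, n=4, k=3); tightness is claimed only for n>k and not when F_{T_u}(u)=n-n' with positive bound, where it fails (n=7, k=3: bound 1, distance 0). *)

theory Defs
  imports Complex_Main
begin

record 'a graph =
  verts :: "'a set"
  edges :: "'a set set"

definition simple_graph :: "'a graph \<Rightarrow> bool" where
  "simple_graph G \<longleftrightarrow> finite (verts G) \<and> (\<forall>e\<in>edges G. e \<subseteq> verts G \<and> card e = 2)"

definition order :: "'a graph \<Rightarrow> nat" where
  "order G = card (verts G)"

definition adj :: "'a graph \<Rightarrow> 'a \<Rightarrow> 'a \<Rightarrow> bool" where
  "adj G x y \<longleftrightarrow> {x, y} \<in> edges G"

definition degree :: "'a graph \<Rightarrow> 'a \<Rightarrow> nat" where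
  "degree G v = card {w \<in> verts G. adj G v w}"

definition max_degree :: "'a graph \<Rightarrow> nat" where
  "max_degree G = Max (degree G ` verts G)"

definition is_path :: "'a graph \<Rightarrow> 'a list \<Rightarrow> bool" where
  "is_path G p \<longleftrightarrow> p \<noteq> [] \<and> distinct p \<and> set p \<subseteq> verts G \<and> successively (adj G) p"

definition path_between :: "'a graph \<Rightarrow> 'a \<Rightarrow> 'a list \<Rightarrow> 'a \<Rightarrow> bool" where
  "path_between G u p v \<longleftrightarrow> is_path G p \<and> hd p = u \<and> last p = v"

definition connected_graph :: "'a graph \<Rightarrow> bool" where
  "connected_graph G \<longleftrightarrow>
     verts G \<noteq> {} \<and> (\<forall>u\<in>verts G. \<forall>v\<in>verts G. \<exists>p. path_between G u p v)"

definition has_cycle :: "'a graph \<Rightarrow> bool" where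
  "has_cycle G \<longleftrightarrow> (\<exists>p. is_path G p \<and> length p \<ge> 3 \<and> adj G (last p) (hd p))"

definition tree :: "'a graph \<Rightarrow> bool" where
  "tree G \<longleftrightarrow> simple_graph G \<and> connected_graph G \<and> \<not> has_cycle G"

text \<open>Distances are only meant for trees, where the path between two vertices is unique.\<close>

definition tree_dist :: "'a graph \<Rightarrow> 'a \<Rightarrow> 'a \<Rightarrow> nat" where
  "tree_dist T u v = length (THE p. path_between T u p v) - 1"

definition vertex_distance :: "'a graph \<Rightarrow> 'a \<Rightarrow> nat" where
  "vertex_distance T v = (\<Sum>u\<in>verts T. tree_dist T v u)"

definition centroid :: "'a graph \<Rightarrow> 'a set" where
  "centroid T = {v \<in> verts T. \<forall>w\<in>verts T. vertex_distance T v \<le> vertex_distance T w}"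

definition induced_subgraph :: "'a graph \<Rightarrow> 'a set \<Rightarrow> 'a graph" where
  "induced_subgraph G S = \<lparr>verts = S, edges = {e \<in> edges G. e \<subseteq> S}\<rparr>"

text \<open>A subtree is an induced subgraph, so it is represented by its vertex set.\<close>

definition subtrees :: "'a graph \<Rightarrow> 'a set set" where
  "subtrees T = {S. S \<noteq> {} \<and> S \<subseteq> verts T \<and> connected_graph (induced_subgraph T S)}"

definition num_subtrees :: "'a graph \<Rightarrow> 'a \<Rightarrow> nat" where
  "num_subtrees T v = card {S \<in> subtrees T. v \<in> S}"

definition subtree_core :: "'a graph \<Rightarrow> 'a set" where
  "subtree_core T = {v \<in> verts T. \<forall>w\<in>verts T. num_subtrees T w \<le> num_subtrees T v}"

definition set_dist :: "'a graph \<Rightarrow> 'a set \<Rightarrow> 'a set \<Rightarrow> nat" where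
  "set_dist T A B = Min {tree_dist T u v | u v. u \<in> A \<and> v \<in> B}"

definition tree_degree_sequence :: "nat list \<Rightarrow> bool" where
  "tree_degree_sequence ds \<longleftrightarrow>
     sorted_wrt (\<ge>) ds \<and>
     (\<exists>G :: nat graph. tree G \<and> verts G = {..<length ds} \<and>
        (\<forall>i<length ds. degree G i = ds ! i))"

text \<open>
  The rooted greedy tree of the degree sequence \<open>ds\<close> whose distinguished (root) entry is
  \<open>ds ! r\<close>. Its vertices are numbered level by level and from left to right within each level;
  the root is \<open>0\<close>. Since the entries are handed out in exactly this order, vertex
  \<open>i > 0\<close> has degree \<open>d' ! (i - 1)\<close>, where \<open>d'\<close> is \<open>ds\<close> without its distinguished entry.
  The children of the vertices \<open>0, 1, 2, \<dots>\<close> form consecutive blocks of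
  the numbers \<open>1, 2, 3, \<dots>\<close>; the block of vertex \<open>i\<close> starts at \<open>greedy_first_child ds r i\<close>.
\<close>

definition greedy_num_children :: "nat list \<Rightarrow> nat \<Rightarrow> nat \<Rightarrow> nat" where
  "greedy_num_children ds r i =
     (let d' = take r ds @ drop (Suc r) ds
      in if i = 0 then ds ! r else d' ! (i - 1) - 1)"

definition greedy_first_child :: "nat list \<Rightarrow> nat \<Rightarrow> nat \<Rightarrow> nat" where
  "greedy_first_child ds r i = 1 + (\<Sum>j<i. greedy_num_children ds r j)"

definition rooted_greedy_tree :: "nat list \<Rightarrow> nat \<Rightarrow> nat graph" where
  "rooted_greedy_tree ds r =
     \<lparr>verts = {..<length ds},
      edges = {{i, j} | i j. i < length ds \<and>
                 greedy_first_child ds r i \<le> j \<and> j < greedy_first_child ds r (Suc i)}\<rparr>"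

text \<open>
  The numbers of leading entries \<open>k\<close> and of trailing entries \<open>1\<close> may be zero. For example, the star
  with \<open>k\<close> vertices rooted at its centre is the smallest extended rgood tree with parameter \<open>k\<close>:
  its root has degree \<open>k - 1\<close>, and reaches degree \<open>k\<close> once a path is attached to it.
\<close>

definition extended_rgood_tree :: "nat \<Rightarrow> nat \<Rightarrow> nat graph \<Rightarrow> nat \<Rightarrow> bool" where
  "extended_rgood_tree m k G u \<longleftrightarrow>
     (\<exists>a s b. let ds = replicate a k @ [k - 1, s] @ replicate b 1 in
        1 \<le> s \<and> s < k \<and> length ds = m \<and> tree_degree_sequence ds \<and>
        G = rooted_greedy_tree ds a \<and> u = 0)"

definition admissible_rgood_tree :: "nat \<Rightarrow> nat \<Rightarrow> nat \<Rightarrow> nat graph \<Rightarrow> nat \<Rightarrow> bool" where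
  "admissible_rgood_tree n k m G u \<longleftrightarrow>
     extended_rgood_tree m k G u \<and> int (num_subtrees G u) \<ge> int n - int (order G)"

text \<open>
  Stated as a relation because no extended rgood tree exists for \<open>k = 1\<close>
  (there is no \<open>s\<close> with \<open>1 \<le> s < 1\<close>), so that the minimum is then undefined.
\<close>

definition is_min_rgood_order :: "nat \<Rightarrow> nat \<Rightarrow> nat \<Rightarrow> bool" where
  "is_min_rgood_order n k n' \<longleftrightarrow>
     (\<exists>G u. admissible_rgood_tree n k n' G u) \<and>
     (\<forall>m G u. admissible_rgood_tree n k m G u \<longrightarrow> n' \<le> m)"

text \<open>
  \<open>attach_path G u l\<close> identifies \<open>u\<close> with the end \<open>p 0\<close> of a path \<open>p 0, \<dots>, p l\<close> with \<open>l\<close> edges;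
  the other path vertices \<open>Inr 1, \<dots>, Inr l\<close> are new.
\<close>

definition attach_path :: "'a graph \<Rightarrow> 'a \<Rightarrow> nat \<Rightarrow> ('a + nat) graph" where
  "attach_path G u l =
     (let p = (\<lambda>i. if i = 0 then Inl u else Inr i) in
      \<lparr>verts = Inl ` verts G \<union> p ` {..l},
       edges = (\<lambda>e. Inl ` e) ` edges G \<union> {{p i, p (Suc i)} | i. i < l}\<rparr>)"

text \<open>
  Two boundary effects of the bound \<open>n - n' - \<lceil>(n + 1) / 2\<rceil> + 1\<close>: it is negative for
  \<open>k < n < 2 k - 1\<close> (e.g. for stars with at least four vertices), where a distance can only be compared
  with \<open>0\<close>. And if \<open>num_subtrees G u = n - n'\<close> holds with equality, the subtree core of the tree \<open>attach_path G u (n - n')\<close>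
  consists of both \<open>u\<close> and its neighbour on the attached path; when the bound is positive, the
  distance from the core to the centroid is then one less than the bound.
  For example, with \<open>n = 7\<close> and \<open>k = 3\<close> one has \<open>n' = 3\<close> and bound \<open>1\<close>, but distance \<open>0\<close>.
\<close>

end

theory Submission
  imports Defs "HOL-Library.Multiset" "HOL-Library.FuncSet"
begin

text \<open>
  Let \<open>x\<close> in the core and \<open>y\<close> in the centroid be as close as possible, let \<open>x1\<close> be the neighbour of \<open>x\<close> towards
  \<open>y\<close>, and let \<open>A\<close>, of order \<open>m\<close>, be the component of \<open>x\<close> after deleting the edge \<open>x x1\<close>. Since \<open>x1\<close> is not in the
  core, \<open>A\<close> has more subtrees containing \<open>x\<close> than the other component has subtrees containing \<open>x1\<close>, and the
  latter number is at least \<open>n - m\<close>, the number of paths starting at \<open>x1\<close>. As the greedy tree maximizes the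
  number of subtrees containing the root, \<open>m \<ge> n'\<close>. Since \<open>y\<close> is strictly better than its predecessor on the path from \<open>x\<close>,
  the \<open>m\<close> vertices of \<open>A\<close> and the \<open>d - 1\<close> inner vertices of that path make up less than half of the tree.

  Maximality of the greedy tree is proved on the level of orders of branches. If \<open>g m\<close> is one plus the maximal
  number of root subtrees, then \<open>g\<close> of a tree is one plus the product of \<open>g\<close> over its branches, so any two
  branches of an optimal tree maximize \<open>g a * g b\<close> for their total order \<open>a + b\<close>. Exchanging branches of
  these branches shows by induction on \<open>a + b\<close> that such pairs are the ones occurring in greedy trees.
\<close>

section \<open>Optimal branch orders\<close>

text \<open>A branch contributes one plus its number of root subtrees because a subtree through the
  parent either misses the branch or meets it in a root subtree. The arity is
  \<open>q = k - 1\<close>: every vertex of \<open>A\<close> spends one edge on its parent, with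
  \<open>x1\<close> as the parent of \<open>x\<close>. The thresholds are the orders
  \<open>csize j\<close> of complete trees. Since \<open>csize (Suc j) = Suc (q * csize j)\<close>,
  a tree above or below one threshold has a branch above or below the preceding one, and this lets
  the induction descend to smaller pairs. What is shown is that optimal pairs are greedy, not the
  converse; the converse follows because a greedy multiset is determined by its size and sum, so
  ties need no analysis. The step to \<open>m >= n'\<close> requires an extended rgood tree of order
  \<open>m\<close>, which exists only for \<open>m >= k\<close>. So \<open>A\<close> must be shown
  to have at least \<open>k\<close> vertices even if the vertices of maximum degree lie on the other
  side.\<close>

text \<open>\<open>max_val q m - 1\<close> is the largest possible number of subtrees containing the root, over rooted trees
  of order \<open>m\<close> in which every vertex has at most \<open>q\<close> children; the empty tree, padding the list of
  branches to length \<open>q\<close>, contributes the factor \<open>1\<close>.\<close>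

function max_val :: "nat \<Rightarrow> nat \<Rightarrow> nat" where
  "max_val q 0 = 1"
| "max_val q (Suc m) =
     Suc (Max ((\<lambda>xs. prod_list (map (max_val q) xs)) ` {xs. length xs = q \<and> sum_list xs = m}))"
  by pat_completeness auto
termination
  by (relation "measure snd") (auto simp: less_Suc_eq_le intro: member_le_sum_list)

declare max_val.simps(2) [simp del]

lemma finite_lists_sum: "finite {xs :: nat list. length xs = q \<and> sum_list xs = m}"
proof (rule finite_subset)
  show "{xs :: nat list. length xs = q \<and> sum_list xs = m} \<subseteq> {xs. set xs \<subseteq> {..m} \<and> length xs = q}"
    using member_le_sum_list by auto
qed (simp add: finite_lists_length_eq)

text \<open>If \<open>x\<close> rises by \<open>d\<close> and \<open>y\<close> falls by
  \<open>e > d\<close>, the product changes by \<open>d * y' - e * x\<close>, which is negative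
  because \<open>y' <= x\<close>.\<close>

lemma sum_ge_of_prod_ge:
  fixes x y x' y' :: nat
  assumes "x * y \<le> x' * y'" "y \<le> x" "x \<le> x'" "y' \<le> y" "0 < x"
  shows "x + y \<le> x' + y'"
proof (rule ccontr)
  assume "\<not> x + y \<le> x' + y'"
  then have less: "x' - x < y - y'" using assms by linarith
  define d e where "d = x' - x" and "e = y - y'"
  have x': "x' = x + d" and y: "y = y' + e" using assms by (auto simp: d_def e_def)
  have "x * e \<le> d * y'" using assms(1) by (simp add: x' y algebra_simps)
  also have "\<dots> \<le> d * x" using assms by simp
  also have "\<dots> < e * x" using less assms by (simp add: d_def e_def)
  finally show False by (simp add: algebra_simps)
qed

text \<open>The two sides differ by \<open>(P * R - S) * (y - x)\<close>. In the exchanges,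
  \<open>1 + P * x\<close> is the value of one tree as a function of one of its branches, and
  \<open>R + S * y\<close> that of the other tree, whose exposed branch may hang one or two levels
  down.\<close>

lemma swap_gain:
  fixes P R S x y :: nat
  assumes "x < y" "S < P * R"
  shows "(1 + P * x) * (R + S * y) < (1 + P * y) * (R + S * x)"
proof -
  obtain d where d: "y = x + d" "0 < d" using assms(1) less_imp_add_positive by blast
  have "S * d < P * R * d" using assms(2) d by simp
  then show ?thesis by (simp add: d algebra_simps)
qed

text \<open>After expansion the term \<open>P * S * x * y\<close> grows, and the linear terms do not
  drop: the sum does not fall, and the variable that rises has weight \<open>P * R\<close>, at least
  the weight \<open>S\<close> of the one that falls.\<close>

lemma spread_gain:
  fixes P R S x y x' y' :: nat
  assumes "x * y < x' * y'" "y \<le> x" "x < x'" "y' < y" "0 < P" "0 < S" "S \<le> P * R"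
  shows "(1 + P * x) * (R + S * y) < (1 + P * x') * (R + S * y')"
proof -
  have sum: "x + y \<le> x' + y'" by (rule sum_ge_of_prod_ge) (use assms in auto)
  define d e where "d = x' - x" and "e = y - y'"
  have x': "x' = x + d" and y: "y = y' + e" using assms by (auto simp: d_def e_def)
  have "S * e \<le> P * R * d" using sum assms(7) by (simp add: x' y mult_mono)
  then have "R + P * R * x + S * y \<le> R + P * R * x' + S * y'"
    by (simp add: x' y algebra_simps)
  moreover have "P * S * (x * y) < P * S * (x' * y')" using assms by simp
  ultimately have "R + P * R * x + S * y + P * S * (x * y) < R + P * R * x' + S * y' + P * S * (x' * y')"
    by linarith
  then show ?thesis by (simp add: algebra_simps)
qed

lemma sum_mset_le_bound: "(\<And>x. x \<in># M \<Longrightarrow> x \<le> (b::nat)) \<Longrightarrow> sum_mset M \<le> size M * b"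
  by (induction M) (auto intro: add_mono)

lemma sum_mset_ge_bound: "(\<And>x. x \<in># M \<Longrightarrow> (b::nat) \<le> x) \<Longrightarrow> size M * b \<le> sum_mset M"
  by (induction M) (auto intro: add_mono)

lemma prod_mset_le_power: "(\<And>x. x \<in># M \<Longrightarrow> f x \<le> (b::nat)) \<Longrightarrow> prod_mset (image_mset f M) \<le> b ^ size M"
  by (induction M) (auto intro: mult_mono)

lemma power_le_prod_mset: "(\<And>x. x \<in># M \<Longrightarrow> (b::nat) \<le> f x) \<Longrightarrow> b ^ size M \<le> prod_mset (image_mset f M)"
  by (induction M) (auto intro: mult_mono)

locale kary =
  fixes q :: nat
  assumes q_pos: "0 < q"
begin

abbreviation G :: "nat \<Rightarrow> nat" where "G \<equiv> max_val q"

abbreviation PG :: "nat multiset \<Rightarrow> nat" where "PG M \<equiv> prod_mset (image_mset G M)"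

text \<open>The order of the complete \<open>q\<close>-ary tree with \<open>j\<close> levels.\<close>

definition csize :: "nat \<Rightarrow> nat" where "csize j = (\<Sum>i<j. q ^ i)"

lemma csize_0 [simp]: "csize 0 = 0"
  and csize_1 [simp]: "csize (Suc 0) = 1"
  by (simp_all add: csize_def)

lemma csize_Suc: "csize (Suc j) = csize j + q ^ j"
  by (simp add: csize_def)

lemma csize_Suc': "csize (Suc j) = Suc (q * csize j)"
  by (simp add: csize_def sum.lessThan_Suc_shift sum_distrib_left del: sum.lessThan_Suc)

lemma csize_less: "i < j \<Longrightarrow> csize i < csize j"
proof (induction j)
  case (Suc j)
  have "csize j < csize (Suc j)" using q_pos by (simp add: csize_Suc)
  then show ?case using Suc by (cases "i = j") auto
qed simp

lemma csize_mono: "i \<le> j \<Longrightarrow> csize i \<le> csize j"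
  using csize_less[of i j] by (cases "i = j") auto

lemma csize_less_iff: "csize i < csize j \<longleftrightarrow> i < j"
  using csize_less csize_mono by (metis leD le_less_linear)

lemma le_csize: "j \<le> csize j"
proof (induction j)
  case (Suc j)
  then show ?case using csize_less[of j "Suc j"] by simp
qed simp

lemma csize_bracket: obtains j where "csize j \<le> a" "a < csize (Suc j)"
proof -
  define j where "j = (LEAST j. a < csize (Suc j))"
  have ex: "\<exists>j. a < csize (Suc j)" using le_csize[of "Suc a"] by (intro exI[of _ a]) simp
  have 1: "a < csize (Suc j)" unfolding j_def by (rule LeastI_ex[OF ex])
  have "csize j \<le> a"
  proof (cases j)
    case (Suc i)
    then have "\<not> a < csize (Suc i)"
      using not_less_Least[of i "\<lambda>j. a < csize (Suc j)"] by (simp flip: j_def)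
    then show ?thesis using Suc by simp
  qed simp
  with 1 that show ?thesis by blast
qed

lemma G_ge:
  assumes "size M = q"
  shows "Suc (PG M) \<le> G (Suc (sum_mset M))"
proof -
  obtain xs where xs: "M = mset xs" using ex_mset by metis
  have "prod_list (map G xs) \<le> Max ((\<lambda>xs. prod_list (map (max_val q) xs)) ` {ys. length ys = q \<and> sum_list ys = sum_mset M})"
    using assms by (intro Max_ge finite_imageI finite_lists_sum imageI) (auto simp: xs sum_mset_sum_list)
  moreover have "PG M = prod_list (map G xs)" by (simp add: xs prod_mset_prod_list flip: mset_map)
  ultimately show ?thesis by (simp add: max_val.simps(2))
qed

definition opt_dec :: "nat \<Rightarrow> nat multiset \<Rightarrow> bool" where
  "opt_dec a M \<longleftrightarrow> size M = q \<and> a = Suc (sum_mset M) \<and> G a = Suc (PG M)"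

lemma opt_dec_exists: "0 < a \<Longrightarrow> \<exists>M. opt_dec a M"
proof -
  assume "0 < a"
  then obtain m where a: "a = Suc m" by (cases a) auto
  let ?S = "{xs. length xs = q \<and> sum_list xs = m}"
  have "m # replicate (q - 1) 0 \<in> ?S" using q_pos by (simp add: sum_list_replicate)
  then have "(\<lambda>xs. prod_list (map G xs)) ` ?S \<noteq> {}" by blast
  then have "Max ((\<lambda>xs. prod_list (map G xs)) ` ?S) \<in> (\<lambda>xs. prod_list (map G xs)) ` ?S"
    by (intro Max_in finite_imageI finite_lists_sum)
  then obtain xs where xs: "length xs = q" "sum_list xs = m"
    "Max ((\<lambda>xs. prod_list (map G xs)) ` ?S) = prod_list (map G xs)" by auto
  have "opt_dec a (mset xs)"
    unfolding opt_dec_def using xs a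
    by (simp add: max_val.simps(2) sum_mset_sum_list prod_mset_prod_list flip: mset_map)
  then show ?thesis by blast
qed

lemma G_pos: "0 < G a"
  using opt_dec_exists[of a] by (cases "a = 0") (auto simp: opt_dec_def)

lemma PG_pos: "0 < PG M"
  using G_pos by (induction M) auto

text \<open>The source of all competitors in the exchanges: one branch of an optimal decomposition
  changes its order, the others stay. As \<open>x < a\<close>, the truncated subtraction is
  exact.\<close>

lemma opt_dec_replace:
  assumes "opt_dec a (add_mset x M)"
  shows "1 + PG M * G x' \<le> G (a - x + x')"
  using G_ge[of "add_mset x' M"] assms by (simp add: opt_dec_def algebra_simps)

lemma opt_dec_G: "opt_dec a (add_mset x M) \<Longrightarrow> G a = 1 + PG M * G x"
  unfolding opt_dec_def by (auto simp: mult.commute)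

text \<open>One branch of an optimal decomposition grows by a vertex, and by induction its factor
  increases. Order \<open>0\<close>, which has no decomposition, is compared with a single vertex
  directly.\<close>

lemma G_less_Suc: "G a < G (Suc a)"
proof (induction a rule: less_induct)
  case (less a)
  show ?case
  proof (cases "a = 0")
    case True
    have "Suc (PG (replicate_mset q 0)) \<le> G (Suc 0)"
      using G_ge[of "replicate_mset q 0"] by simp
    moreover have "0 < PG (replicate_mset q 0)" by (rule PG_pos)
    ultimately have "1 < G (Suc 0)" by linarith
    then show ?thesis using True by simp
  next
    case False
    then obtain M where M: "opt_dec a M" using opt_dec_exists by auto
    then obtain x M' where M': "M = add_mset x M'"
      using q_pos by (metis opt_dec_def less_irrefl multiset_cases size_empty)
    have x: "x < a" using M M' by (auto simp: opt_dec_def)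
    have "G a = 1 + PG M' * G x" using M M' opt_dec_G by auto
    also have "\<dots> < 1 + PG M' * G (Suc x)" using less[OF x] PG_pos by simp
    also have "\<dots> \<le> G (a - x + Suc x)" using M M' opt_dec_replace by blast
    also have "a - x + Suc x = Suc a" using x by simp
    finally show ?thesis .
  qed
qed

lemma G_strict_mono: "a < b \<Longrightarrow> G a < G b"
  using lift_Suc_mono_less[of G, OF G_less_Suc] .

lemma G_mono: "a \<le> b \<Longrightarrow> G a \<le> G b"
  using G_strict_mono[of a b] by (cases "a = b") auto

text \<open>The possible orders of two sibling branches of a greedy tree: they have complete parts of the same
  height, and at most one of them has an incomplete last level.\<close>

definition greedy_pair :: "nat \<Rightarrow> nat \<Rightarrow> bool" where
  "greedy_pair a b \<longleftrightarrow>
     (\<exists>j. csize j \<le> a \<and> a \<le> b \<and> b \<le> csize (Suc j) \<and> (a = csize j \<or> b = csize (Suc j)))"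

definition opt_pair :: "nat \<Rightarrow> nat \<Rightarrow> bool" where
  "opt_pair a b \<longleftrightarrow> (\<forall>a' b'. a' + b' = a + b \<longrightarrow> G a' * G b' \<le> G a * G b)"

lemma opt_pairD: "opt_pair a b \<Longrightarrow> a' + b' = a + b \<Longrightarrow> G a' * G b' \<le> G a * G b"
  by (auto simp: opt_pair_def)

lemma opt_pair_exists: "\<exists>a b. a + b = n \<and> a \<le> b \<and> opt_pair a b"
proof -
  let ?S = "(\<lambda>a. G a * G (n - a)) ` {..n}"
  have "Max ?S \<in> ?S" by (rule Max_in) auto
  then obtain a where a: "a \<le> n" "Max ?S = G a * G (n - a)" by (elim imageE) auto
  have *: "G a' * G b' \<le> G a * G (n - a)" if "a' + b' = n" for a' b'
  proof -
    have "G a' * G (n - a') \<in> ?S" using that by auto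
    then have "G a' * G (n - a') \<le> Max ?S" by (intro Max_ge) auto
    then show ?thesis using that a by auto
  qed
  show ?thesis
  proof (cases "a \<le> n - a")
    case True
    then show ?thesis using a * by (intro exI[of _ a] exI[of _ "n - a"]) (auto simp: opt_pair_def)
  next
    case False
    then show ?thesis using a *
      by (intro exI[of _ "n - a"] exI[of _ a]) (auto simp: opt_pair_def mult.commute)
  qed
qed

lemma not_greedy_pair_inside:
  assumes "csize i < a" "b < csize (Suc i)"
  shows "\<not> greedy_pair a b"
proof
  assume "greedy_pair a b"
  then obtain j where j: "csize j \<le> a" "a \<le> b" "b \<le> csize (Suc j)" "a = csize j \<or> b = csize (Suc j)"
    by (auto simp: greedy_pair_def)
  from j(4) show False
  proof
    assume "a = csize j"
    then have "csize i < csize j" "csize j < csize (Suc i)" using assms j by auto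
    then show False unfolding csize_less_iff by simp
  next
    assume "b = csize (Suc j)"
    then have "csize i < csize (Suc j)" "csize (Suc j) < csize (Suc i)" using assms j by auto
    then show False unfolding csize_less_iff by simp
  qed
qed

text \<open>The form in which the exchanges deliver greediness: a pair fails to be greedy only by
  straddling a threshold \<open>csize i\<close> or by lying strictly between two consecutive
  ones.\<close>

lemma greedy_pairI:
  assumes "a \<le> b" and nosplit: "\<And>i. \<not> (a < csize i \<and> csize i < b)"
    and noinside: "\<And>i. \<not> (csize i < a \<and> b < csize (Suc i))"
  shows "greedy_pair a b"
proof -
  obtain j where j: "csize j \<le> a" "a < csize (Suc j)" by (rule csize_bracket)
  then show ?thesis unfolding greedy_pair_def
    using nosplit[of "Suc j"] noinside[of j] assms(1) by (intro exI[of _ j]) auto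
qed

text \<open>An optimal pair of the same total is greedy by assumption, so it cannot lie strictly
  between the two thresholds; having the same sum as \<open>x, y\<close>, it must be more spread
  than they are.\<close>

lemma spread_exists:
  assumes IH: "\<And>a b. a + b = x + y \<Longrightarrow> a \<le> b \<Longrightarrow> opt_pair a b \<Longrightarrow> greedy_pair a b"
    and "csize i < x" "x \<le> y" "y < csize (Suc i)"
  obtains x' y' where "x' < x" "y < y'" "x' + y' = x + y" "G x * G y < G x' * G y'"
proof -
  obtain x' y' where xy': "x' + y' = x + y" "x' \<le> y'" "opt_pair x' y'"
    using opt_pair_exists by blast
  then have gp: "greedy_pair x' y'" using IH by blast
  have "\<not> opt_pair x y"
    using IH[of x y] assms not_greedy_pair_inside[OF assms(2,4)] by auto
  then obtain a b where "a + b = x + y" "G x * G y < G a * G b"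
    by (auto simp: opt_pair_def not_le)
  then have "G x * G y < G x' * G y'" using opt_pairD[OF xy'(3), of a b] xy'(1) by simp
  moreover have "x' < x"
  proof (rule ccontr)
    assume "\<not> x' < x"
    then have "csize i < x'" "y' < csize (Suc i)" using assms xy' by auto
    then show False using gp not_greedy_pair_inside by blast
  qed
  ultimately show ?thesis using that[of x' y'] xy'(1) by auto
qed

lemma Max_child:
  assumes "opt_dec a M"
  obtains x M' where "M = add_mset x M'" "size M' = q - 1" "\<And>y. y \<in># M \<Longrightarrow> y \<le> x"
proof -
  have "M \<noteq> {#}" using assms q_pos by (auto simp: opt_dec_def)
  then have "Max_mset M \<in># M" by simp
  then obtain M' where M': "M = add_mset (Max_mset M) M'" by (metis multi_member_split)
  moreover have "size M' = q - 1"
    using assms M' unfolding opt_dec_def by (metis diff_Suc_1 size_add_mset)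
  moreover have "\<And>y. y \<in># M \<Longrightarrow> y \<le> Max_mset M" by simp
  ultimately show ?thesis using that by blast
qed

lemma Min_child:
  assumes "opt_dec a M"
  obtains x M' where "M = add_mset x M'" "size M' = q - 1" "\<And>y. y \<in># M \<Longrightarrow> x \<le> y"
proof -
  have "M \<noteq> {#}" using assms q_pos by (auto simp: opt_dec_def)
  then have "Min_mset M \<in># M" by simp
  then obtain M' where M': "M = add_mset (Min_mset M) M'" by (metis multi_member_split)
  moreover have "size M' = q - 1"
    using assms M' unfolding opt_dec_def by (metis diff_Suc_1 size_add_mset)
  moreover have "\<And>y. y \<in># M \<Longrightarrow> Min_mset M \<le> y" by simp
  ultimately show ?thesis using that by blast
qed

text \<open>An averaging argument: if all \<open>q\<close> branches had order at most
  \<open>csize i\<close>, the tree would have at most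
  \<open>Suc (q * csize i) = csize (Suc i)\<close> vertices.\<close>

lemma Max_child_greater:
  assumes "opt_dec a M" "csize (Suc i) < a" "\<And>y. y \<in># M \<Longrightarrow> y \<le> x"
  shows "csize i < x"
proof -
  have "a \<le> Suc (q * x)" using assms sum_mset_le_bound[of M x] by (simp add: opt_dec_def)
  then have "q * csize i < q * x" using assms(2) unfolding csize_Suc' by linarith
  then show ?thesis by simp
qed

lemma Min_child_less:
  assumes "opt_dec a M" "a < csize (Suc i)" "\<And>y. y \<in># M \<Longrightarrow> x \<le> y"
  shows "x < csize i"
proof -
  have "Suc (q * x) \<le> a" using assms sum_mset_ge_bound[of M x] by (simp add: opt_dec_def)
  then have "q * x < q * csize i" using assms(2) unfolding csize_Suc' by linarith
  then show ?thesis by simp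
qed

text \<open>Exchanges between two optimal sibling subtrees: first \<open>a\<close> against a child of \<open>b\<close>, then a child
  of \<open>a\<close> against a grandchild of \<open>b\<close>.\<close>

lemma opt_pair_no_split:
  assumes IH: "\<And>x y. x + y < a + b \<Longrightarrow> x \<le> y \<Longrightarrow> opt_pair x y \<Longrightarrow> greedy_pair x y"
    and opt: "opt_pair a b" and ab: "a < csize i" "csize i < b"
  shows False
proof -
  obtain M where M: "opt_dec b M" using opt_dec_exists[of b] ab by auto
  obtain b1 M' where b1: "M = add_mset b1 M'" "\<And>y. y \<in># M \<Longrightarrow> y \<le> b1"
    using Max_child[OF M] by metis
  have b1_less: "b1 < b" using M b1(1) by (auto simp: opt_dec_def)
  have Gb: "G b = 1 + PG M' * G b1" using M b1 opt_dec_G by blast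
  \<comment> \<open>Otherwise exchange \<open>a\<close> with the branch \<open>b1\<close>:
    \<open>G a * G b\<close> is \<open>G a\<close> plus a term symmetric in \<open>G a\<close> and
    \<open>G b1\<close>, so replacing the first summand by \<open>G b1\<close> gains.\<close>
  have "b1 \<le> a"
  proof (rule ccontr)
    assume "\<not> b1 \<le> a"
    then have "G a < G b1" by (simp add: G_strict_mono)
    then have "G a * G b < G b1 * (1 + PG M' * G a)" by (simp add: Gb algebra_simps)
    also have "\<dots> \<le> G b1 * G (b - b1 + a)"
      using opt_dec_replace[of b b1 M' a] M b1(1) by (intro mult_left_mono) auto
    also have "\<dots> \<le> G a * G b" using opt_pairD[OF opt, of b1 "b - b1 + a"] b1_less by simp
    finally show False by simp
  qed
  obtain i1 where i1: "i = Suc i1" using ab by (cases i) auto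
  have "csize i1 < b1" using Max_child_greater[OF M] ab b1 i1 by blast
  \<comment> \<open>For \<open>i1 = 0\<close> one would have
    \<open>0 < b1 <= a < csize 1 = 1\<close>.\<close>
  obtain i2 where i2: "i1 = Suc i2" using \<open>csize i1 < b1\<close> \<open>b1 \<le> a\<close> ab i1 by (cases i1) auto
  obtain A where A: "opt_dec a A" using opt_dec_exists[of a] \<open>csize i1 < b1\<close> \<open>b1 \<le> a\<close> by auto
  obtain B where B: "opt_dec b1 B" using opt_dec_exists[of b1] \<open>csize i1 < b1\<close> by auto
  obtain x A' where x: "A = add_mset x A'" "size A' = q - 1" "\<And>z. z \<in># A \<Longrightarrow> x \<le> z"
    using Min_child[OF A] by metis
  obtain y B' where y: "B = add_mset y B'" "size B' = q - 1" "\<And>z. z \<in># B \<Longrightarrow> z \<le> y"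
    using Max_child[OF B] by metis
  have x_less: "x < a" and y_less: "y < b1" using A B x(1) y(1) by (auto simp: opt_dec_def)
  have xi: "x < csize i1" using Min_child_less[OF A] ab x i1 by blast
  have yi: "csize i2 < y" using Max_child_greater[OF B] \<open>csize i1 < b1\<close> y i2 by blast
  have Ga: "G a = 1 + PG A' * G x" using A x opt_dec_G by blast
  have Gb1: "G b1 = 1 + PG B' * G y" using B y opt_dec_G by blast
  \<comment> \<open>\<open>G b\<close> is affine in the value of the grandchild branch
    \<open>y\<close>; the constant 1 in \<open>R\<close> is what makes \<open>SR\<close>
    strict.\<close>
  define R S where "R = 1 + PG M'" and "S = PG M' * PG B'"
  have Gb': "G b = R + S * G y" by (simp add: Gb Gb1 R_def S_def algebra_simps)
  have SR: "S < PG A' * R" if "PG B' \<le> PG A'"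
  proof -
    have "S \<le> PG A' * PG M'" using that by (simp add: S_def mult.commute)
    then show ?thesis using PG_pos[of A'] by (simp add: R_def)
  qed
  have replace: "(1 + PG A' * G x') * (R + S * G y') \<le> G a * G b" if "x' + y' = x + y" for x' y'
  proof -
    have "R + S * G y' = 1 + PG M' * (1 + PG B' * G y')" by (simp add: R_def S_def algebra_simps)
    also have "\<dots> \<le> 1 + PG M' * G (b1 - y + y')"
      using opt_dec_replace[of b1 y B' y'] B y(1) by (intro add_left_mono mult_left_mono) auto
    also have "\<dots> \<le> G (b - b1 + (b1 - y + y'))"
      using opt_dec_replace[of b b1 M'] M b1 by blast
    finally have "(1 + PG A' * G x') * (R + S * G y') \<le> G (a - x + x') * G (b - b1 + (b1 - y + y'))"
      using opt_dec_replace[of a x A' x'] A x by (intro mult_mono) auto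
    also have "\<dots> \<le> G a * G b"
      using opt_pairD[OF opt] that x_less y_less b1_less by simp
    finally show ?thesis .
  qed
  \<comment> \<open>If \<open>x < y\<close>, then \<open>b1 <= a\<close> leaves the smaller product
    to the other branches of \<open>b1\<close>, and swapping \<open>x\<close> with \<open>y\<close>
    gains.\<close>
  have "y \<le> x"
  proof (rule ccontr)
    assume "\<not> y \<le> x"
    then have less: "G x < G y" by (simp add: G_strict_mono)
    have "PG B' * G y \<le> PG A' * G x" using G_mono[OF \<open>b1 \<le> a\<close>] by (simp add: Ga Gb1)
    also have "\<dots> \<le> PG A' * G y" using less by simp
    finally have "PG B' \<le> PG A'" using G_pos[of y] by simp
    then have "(1 + PG A' * G x) * (R + S * G y) < (1 + PG A' * G y) * (R + S * G x)"
      using swap_gain less SR by blast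
    also have "\<dots> \<le> G a * G b" by (rule replace) simp
    finally show False by (simp add: Ga Gb')
  qed
  \<comment> \<open>Every branch in \<open>B'\<close> is at most \<open>y\<close>, every branch in
    \<open>A'\<close> is at least \<open>x\<close>, and both multisets have \<open>q - 1\<close>
    elements.\<close>
  have "PG B' \<le> G y ^ size B'"
    by (rule prod_mset_le_power) (use y in \<open>auto intro: G_mono\<close>)
  also have "\<dots> = G y ^ size A'" by (simp add: x y)
  also have "\<dots> \<le> PG A'"
  proof (rule power_le_prod_mset)
    fix z assume "z \<in># A'"
    then have "x \<le> z" using x by auto
    then show "G y \<le> G z" using \<open>y \<le> x\<close> by (intro G_mono) simp
  qed
  finally have PG_le: "PG B' \<le> PG A'" .
  have IH': "\<And>a' b'. a' + b' = y + x \<Longrightarrow> a' \<le> b' \<Longrightarrow> opt_pair a' b' \<Longrightarrow> greedy_pair a' b'"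
    using IH x_less y_less b1_less by simp
  \<comment> \<open>Now \<open>csize i2 < y <= x < csize (Suc i2)\<close>, so this smaller pair can
    be spread; the larger part goes to \<open>a\<close>, whose weight \<open>PG A' * R\<close>
    exceeds \<open>S\<close>.\<close>
  obtain y' x' where s: "y' < y" "x < x'" "y' + x' = y + x" "G y * G x < G y' * G x'"
    using spread_exists[OF IH' yi \<open>y \<le> x\<close> xi[unfolded i2]] by blast
  have "(1 + PG A' * G x) * (R + S * G y) < (1 + PG A' * G x') * (R + S * G y')"
    using s SR[OF PG_le] \<open>y \<le> x\<close>
    by (intro spread_gain) (auto simp: G_strict_mono G_mono PG_pos S_def mult.commute)
  also have "\<dots> \<le> G a * G b" by (rule replace) (use s in auto)
  finally show False by (simp add: Ga Gb')
qed

text \<open>Here the exchange takes place one level down on both sides: the largest child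
  \<open>x\<close> of \<open>a\<close> against the smallest child \<open>y\<close> of
  \<open>b\<close>. If \<open>y < x\<close>, swapping them gains; otherwise both lie strictly
  between two lower thresholds, and spreading them gains.\<close>

lemma opt_pair_no_inside:
  assumes IH: "\<And>x y. x + y < a + b \<Longrightarrow> x \<le> y \<Longrightarrow> opt_pair x y \<Longrightarrow> greedy_pair x y"
    and opt: "opt_pair a b" and ab: "csize i < a" "a \<le> b" "b < csize (Suc i)"
  shows False
proof -
  obtain i1 where i1: "i = Suc i1" using ab by (cases i) auto
  obtain A where A: "opt_dec a A" using opt_dec_exists[of a] ab by auto
  obtain B where B: "opt_dec b B" using opt_dec_exists[of b] ab by auto
  obtain x A' where x: "A = add_mset x A'" "size A' = q - 1" "\<And>z. z \<in># A \<Longrightarrow> z \<le> x"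
    using Max_child[OF A] by metis
  obtain y B' where y: "B = add_mset y B'" "size B' = q - 1" "\<And>z. z \<in># B \<Longrightarrow> y \<le> z"
    using Min_child[OF B] by metis
  have x_less: "x < a" and y_less: "y < b" using A B x(1) y(1) by (auto simp: opt_dec_def)
  have xi: "csize i1 < x" using Max_child_greater[OF A] ab x i1 by blast
  have yi: "y < csize i" using Min_child_less[OF B] ab y by blast
  have Ga: "G a = 1 + PG A' * G x" using A x opt_dec_G by blast
  have Gb: "G b = 1 + PG B' * G y" using B y opt_dec_G by blast
  have replace: "(1 + PG A' * G x') * (1 + PG B' * G y') \<le> G a * G b" if "x' + y' = x + y" for x' y'
  proof -
    have "(1 + PG A' * G x') * (1 + PG B' * G y') \<le> G (a - x + x') * G (b - y + y')"
      using opt_dec_replace[of a x A' x'] opt_dec_replace[of b y B' y'] A x B y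
      by (intro mult_mono) auto
    also have "\<dots> \<le> G a * G b" using opt_pairD[OF opt] that x_less y_less by simp
    finally show ?thesis .
  qed
  have "x \<le> y"
  proof (rule ccontr)
    assume "\<not> x \<le> y"
    then have less: "G y < G x" by (simp add: G_strict_mono)
    have "PG A' * G x \<le> PG B' * G y" using G_mono[OF ab(2)] by (simp add: Ga Gb)
    also have "\<dots> < PG B' * G x" using less PG_pos by simp
    finally have "PG A' < PG B'" by simp
    then have "(1 + PG B' * G y) * (1 + PG A' * G x) < (1 + PG B' * G x) * (1 + PG A' * G y)"
      using swap_gain[OF less, of "PG A'" "PG B'" 1] by simp
    also have "\<dots> \<le> G a * G b" using replace[of y x] by (simp add: mult.commute)
    finally show False by (simp add: Ga Gb mult.commute)
  qed
  have "PG A' \<le> G x ^ size A'"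
    by (rule prod_mset_le_power) (use x in \<open>auto intro: G_mono\<close>)
  also have "\<dots> = G x ^ size B'" by (simp add: x y)
  also have "\<dots> \<le> PG B'"
  proof (rule power_le_prod_mset)
    fix z assume "z \<in># B'"
    then have "y \<le> z" using y by auto
    then show "G x \<le> G z" using \<open>x \<le> y\<close> by (intro G_mono) simp
  qed
  finally have PG_le: "PG A' \<le> PG B'" .
  have IH': "\<And>a' b'. a' + b' = x + y \<Longrightarrow> a' \<le> b' \<Longrightarrow> opt_pair a' b' \<Longrightarrow> greedy_pair a' b'"
    using IH x_less y_less by simp
  obtain x' y' where s: "x' < x" "y < y'" "x' + y' = x + y" "G x * G y < G x' * G y'"
    using spread_exists[OF IH' xi \<open>x \<le> y\<close> yi[unfolded i1]] by blast
  have "(1 + PG B' * G y) * (1 + PG A' * G x) < (1 + PG B' * G y') * (1 + PG A' * G x')"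
    using s PG_le \<open>x \<le> y\<close>
    by (intro spread_gain) (auto simp: G_strict_mono G_mono PG_pos mult.commute)
  also have "\<dots> \<le> G a * G b" using replace[of x' y'] s by (simp add: mult.commute)
  finally show False by (simp add: Ga Gb mult.commute)
qed

lemma opt_pair_greedy:
  assumes "a \<le> b" "opt_pair a b"
  shows "greedy_pair a b"
  using assms
proof (induction "a + b" arbitrary: a b rule: less_induct)
  case less
  have IH: "\<And>x y. x + y < a + b \<Longrightarrow> x \<le> y \<Longrightarrow> opt_pair x y \<Longrightarrow> greedy_pair x y"
    using less.hyps by blast
  show ?case
    using opt_pair_no_split[OF IH less.prems(2)] opt_pair_no_inside[OF IH less.prems(2) _ less.prems(1)]
    by (intro greedy_pairI less.prems) blast+
qed

section \<open>Uniqueness of greedy multisets\<close>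

definition greedy_mset :: "nat multiset \<Rightarrow> bool" where
  "greedy_mset M \<longleftrightarrow> (\<forall>a b M'. M = add_mset a (add_mset b M') \<and> a \<le> b \<longrightarrow> greedy_pair a b)"

lemma opt_dec_greedy:
  assumes "opt_dec m M"
  shows "greedy_mset M"
  unfolding greedy_mset_def
proof (intro allI impI, elim conjE)
  fix a b M' assume M: "M = add_mset a (add_mset b M')" and "a \<le> b"
  have "opt_pair a b"
    unfolding opt_pair_def
  proof (intro allI impI)
    fix a' b' assume *: "a' + b' = a + b"
    have "Suc (PG (add_mset a' (add_mset b' M'))) \<le> Suc (PG M)"
      using G_ge[of "add_mset a' (add_mset b' M')"] assms * by (auto simp: M opt_dec_def simp flip: add.assoc)
    then have le: "(G a' * G b') * PG M' \<le> (G a * G b) * PG M'" by (simp add: M mult.assoc)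
    then show "G a' * G b' \<le> G a * G b"
      by (rule mult_right_le_imp_le) (rule PG_pos)
  qed
  then show "greedy_pair a b" using \<open>a \<le> b\<close> opt_pair_greedy by blast
qed

lemma mset_two_values:
  assumes "\<And>x. x \<in># M \<Longrightarrow> x = a \<or> x = b"
  shows "\<exists>s t. M = replicate_mset s a + replicate_mset t b"
  using assms
proof (induction M)
  case (add x M)
  then obtain s t where M: "M = replicate_mset s a + replicate_mset t b" by fastforce
  show ?case
  proof (cases "x = a")
    case True
    then show ?thesis using M by (intro exI[of _ "Suc s"] exI[of _ t]) simp
  next
    case False
    then show ?thesis using M add.prems[of x] by (intro exI[of _ s] exI[of _ "Suc t"]) simp
  qed
qed simp

text \<open>The least element fixes the level \<open>j\<close>, and two elements strictly between
  \<open>csize j\<close> and \<open>csize (Suc j)\<close> would violate pairwise greediness. One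
  element is always singled out as \<open>csize j + r\<close>, with both \<open>r = 0\<close> and
  \<open>r = q ^ j\<close> allowed.\<close>

lemma greedy_mset_form:
  assumes M: "greedy_mset M" "M \<noteq> {#}"
  shows "\<exists>j r s t. r \<le> q ^ j \<and>
    M = add_mset (csize j + r) (replicate_mset s (csize j) + replicate_mset t (csize (Suc j)))"
proof -
  obtain a N where N: "M = add_mset a N" and a_min: "\<And>x. x \<in># M \<Longrightarrow> a \<le> x"
    by (metis M(2) Min_in Min_le finite_set_mset multi_member_split set_mset_eq_empty_iff)
  obtain j where j: "csize j \<le> a" "a < csize (Suc j)" by (rule csize_bracket)
  have level: "b \<le> csize (Suc j) \<and> (a = csize j \<or> b = csize (Suc j))" if b: "b \<in># N" for b
  proof -
    obtain N' where "N = add_mset b N'" using b by (metis multi_member_split)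
    then have "greedy_pair a b" using M(1) N a_min b unfolding greedy_mset_def by auto
    then obtain i where i: "csize i \<le> a" "a \<le> b" "b \<le> csize (Suc i)" "a = csize i \<or> b = csize (Suc i)"
      by (auto simp: greedy_pair_def)
    have "csize i < csize (Suc j)" using i j by linarith
    then have "i \<le> j" by (simp add: csize_less_iff)
    show ?thesis
    proof (cases "i = j")
      case False
      then have "csize (Suc i) \<le> csize j" using \<open>i \<le> j\<close> by (intro csize_mono) simp
      then show ?thesis using i j by linarith
    qed (use i in auto)
  qed
  show ?thesis
  proof (cases "a = csize j")
    case False
    then have "\<And>b. b \<in># N \<Longrightarrow> b = csize (Suc j) \<or> b = csize (Suc j)" using level by auto
    then obtain s t where "N = replicate_mset s (csize (Suc j)) + replicate_mset t (csize (Suc j))"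
      using mset_two_values by metis
    then have "M = add_mset (csize j + (a - csize j))
        (replicate_mset 0 (csize j) + replicate_mset (s + t) (csize (Suc j)))"
      using N j by (auto simp: multiset_eq_iff)
    moreover have "a - csize j \<le> q ^ j" using j by (simp add: csize_Suc)
    ultimately show ?thesis by blast
  next
    case True
    show ?thesis
    proof (cases "\<exists>b\<in>#N. b \<noteq> csize j \<and> b \<noteq> csize (Suc j)")
      case False
      then obtain s t where "N = replicate_mset s (csize j) + replicate_mset t (csize (Suc j))"
        using mset_two_values by metis
      then have "M = add_mset (csize j + 0) (replicate_mset s (csize j) + replicate_mset t (csize (Suc j)))"
        using N True by simp
      then show ?thesis by blast
    next
      case ex: True
      then obtain b N' where b: "N = add_mset b N'" "b \<noteq> csize j" "b \<noteq> csize (Suc j)"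
        by (metis multi_member_split)
      have b_in: "csize j < b" "b < csize (Suc j)"
        using b level[of b] a_min[of b] N True by auto
      have "x = csize j \<or> x = csize (Suc j)" if x: "x \<in># N'" for x
      proof (rule ccontr)
        assume "\<not> ?thesis"
        then have x_in: "csize j < x" "x < csize (Suc j)"
          using x b level[of x] a_min[of x] N True by auto
        obtain N'' where "N' = add_mset x N''" using x by (metis multi_member_split)
        then have "M = add_mset x (add_mset b (add_mset a N''))" "M = add_mset b (add_mset x (add_mset a N''))"
          using N b by auto
        then have "greedy_pair x b \<or> greedy_pair b x"
          using M(1) unfolding greedy_mset_def by (metis linear)
        then show False using not_greedy_pair_inside x_in b_in by blast
      qed
      then obtain s t where "N' = replicate_mset s (csize j) + replicate_mset t (csize (Suc j))"
        using mset_two_values by metis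
      then have "M = add_mset (csize j + (b - csize j))
          (replicate_mset (Suc s) (csize j) + replicate_mset t (csize (Suc j)))"
        using N b True b_in by simp
      moreover have "b - csize j \<le> q ^ j" using b_in by (simp add: csize_Suc)
      ultimately show ?thesis by blast
    qed
  qed
qed

lemma mset_all_eq:
  assumes "\<And>x. x \<in># M \<Longrightarrow> x \<le> (c::nat)" "sum_mset M = size M * c"
  shows "M = replicate_mset (size M) c"
  using assms
proof (induction M)
  case (add x M)
  have "sum_mset M \<le> size M * c" using add.prems sum_mset_le_bound[of M c] by auto
  moreover have "x \<le> c" using add.prems by simp
  moreover have "x + sum_mset M = c + size M * c" using add.prems(2) by simp
  ultimately have "x = c" "sum_mset M = size M * c" by linarith+
  then show ?case using add by auto
qed simp

lemma mset_all_eq':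
  assumes "\<And>x. x \<in># M \<Longrightarrow> (c::nat) \<le> x" "sum_mset M = size M * c"
  shows "M = replicate_mset (size M) c"
  using assms
proof (induction M)
  case (add x M)
  have "size M * c \<le> sum_mset M" using add.prems sum_mset_ge_bound[of M c] by auto
  moreover have "c \<le> x" using add.prems by simp
  moreover have "x + sum_mset M = c + size M * c" using add.prems(2) by simp
  ultimately have "x = c" "sum_mset M = size M * c" by linarith+
  then show ?case using add by auto
qed simp

text \<open>Equal sizes and sums on opposite sides of \<open>c\<close> leave no room: every element
  must be \<open>c\<close>.\<close>

lemma mset_separated_eq:
  assumes "\<And>x. x \<in># M \<Longrightarrow> x \<le> (c::nat)" "\<And>x. x \<in># N \<Longrightarrow> c \<le> x"
    "size M = size N" "sum_mset M = sum_mset N"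
  shows "M = N"
proof -
  have "sum_mset M \<le> size M * c" "size N * c \<le> sum_mset N"
    using assms sum_mset_le_bound sum_mset_ge_bound by blast+
  then have "sum_mset M = size M * c" "sum_mset N = size N * c" using assms by auto
  then have "M = replicate_mset (size M) c" "N = replicate_mset (size N) c"
    using mset_all_eq[of M c] mset_all_eq'[of N c] assms by blast+
  then show ?thesis using assms(3) by simp
qed

text \<open>Equality of \<open>r + t * Q\<close> with both remainders at most \<open>Q\<close>
  leaves \<open>t' = t\<close>, or \<open>t' = t + 1\<close> with \<open>r = Q\<close> and
  \<open>r' = 0\<close>; in the latter case the two forms describe the same multiset.\<close>

lemma greedy_form_unique:
  assumes "r \<le> Q" "r' \<le> Q" "s + t = s' + t'" "r + t * Q = r' + t' * Q" "0 < (Q::nat)" "t \<le> t'"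
  shows "add_mset (c + r) (replicate_mset s c + replicate_mset t (c + Q)) =
    add_mset (c + r') (replicate_mset s' c + replicate_mset t' (c + Q))"
proof -
  obtain d where d: "t' = t + d" using assms(6) le_Suc_ex by blast
  have "r = r' + d * Q" using assms(4) by (simp add: d algebra_simps)
  have "d = 0 \<or> d = 1"
  proof (rule ccontr)
    assume "\<not> ?thesis"
    then have "2 * Q \<le> d * Q" by (intro mult_right_mono) auto
    then show False using \<open>r = r' + d * Q\<close> assms by linarith
  qed
  then show ?thesis
  proof
    assume "d = 0"
    then show ?thesis using d assms \<open>r = r' + d * Q\<close> by simp
  next
    assume "d = 1"
    then have "r = Q" "r' = 0" "t' = Suc t" "s = Suc s'" using d assms \<open>r = r' + d * Q\<close> by auto
    then show ?thesis by simp
  qed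
qed

lemma greedy_mset_unique:
  assumes "greedy_mset M" "greedy_mset N" "size M = size N" "sum_mset M = sum_mset N"
  shows "M = N"
proof (cases "M = {#}")
  case True
  then show ?thesis using assms(3) by simp
next
  case False
  then have "N \<noteq> {#}" using assms(3) by auto
  obtain j r s t where M: "r \<le> q ^ j"
    "M = add_mset (csize j + r) (replicate_mset s (csize j) + replicate_mset t (csize (Suc j)))"
    using greedy_mset_form[OF assms(1) False] by metis
  obtain j' r' s' t' where N: "r' \<le> q ^ j'"
    "N = add_mset (csize j' + r') (replicate_mset s' (csize j') + replicate_mset t' (csize (Suc j')))"
    using greedy_mset_form[OF assms(2) \<open>N \<noteq> {#}\<close>] by metis
  have Mb: "csize j \<le> x" "x \<le> csize (Suc j)" if "x \<in># M" for x
    using that M by (auto simp: csize_Suc split: if_splits)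
  have Nb: "csize j' \<le> x" "x \<le> csize (Suc j')" if "x \<in># N" for x
    using that N by (auto simp: csize_Suc split: if_splits)
  consider "j < j'" | "j' < j" | "j = j'" by linarith
  then show ?thesis
  proof cases
    case 1
    then have "csize (Suc j) \<le> csize j'" by (intro csize_mono) simp
    then show ?thesis using mset_separated_eq[of M "csize j'" N] Mb Nb assms by (meson order_trans)
  next
    case 2
    then have "csize (Suc j') \<le> csize j" by (intro csize_mono) simp
    then show ?thesis using mset_separated_eq[of N "csize j" M] Mb Nb assms by (metis order_trans)
  next
    case 3
    have size: "s + t = s' + t'" using assms(3) M N by simp
    have "csize j + r + (s * csize j + t * (csize j + q ^ j)) =
        csize j + r' + (s' * csize j + t' * (csize j + q ^ j))"
      using assms(4) M N 3 by (simp add: csize_Suc)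
    then have "csize j + (s + t) * csize j + (r + t * q ^ j) =
        csize j + (s' + t') * csize j + (r' + t' * q ^ j)" by (simp add: algebra_simps)
    then have eq: "r + t * q ^ j = r' + t' * q ^ j" using size by simp
    show ?thesis
    proof (cases "t \<le> t'")
      case True
      then show ?thesis
        using greedy_form_unique[of r "q ^ j" r' s t s' t'] M N 3 size eq q_pos by (simp add: csize_Suc)
    next
      case False
      then show ?thesis
        using greedy_form_unique[of r' "q ^ j" r s' t' s t] M N 3 size eq q_pos by (simp add: csize_Suc)
    qed
  qed
qed

text \<open>An optimal decomposition exists and is greedy, so by uniqueness it is \<open>M\<close>;
  this turns necessity of the greedy shape into optimality.\<close>

lemma G_greedy:
  assumes "greedy_mset M" "size M = q"
  shows "G (Suc (sum_mset M)) = Suc (PG M)"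
proof -
  obtain N where N: "opt_dec (Suc (sum_mset M)) N" using opt_dec_exists by blast
  then have "N = M"
    using greedy_mset_unique[OF opt_dec_greedy[OF N] assms(1)] assms(2) by (simp add: opt_dec_def)
  then show ?thesis using N by (simp add: opt_dec_def)
qed

end

section \<open>Paths and rooted trees\<close>

lemma adj_commute: "adj G x y \<longleftrightarrow> adj G y x"
  by (simp add: adj_def insert_commute)

lemma successively_adj_rev: "successively (adj G) (rev q) \<longleftrightarrow> successively (adj G) q"
proof -
  have "(\<lambda>x y. adj G y x) = adj G" by (intro ext) (rule adj_commute)
  then show ?thesis unfolding successively_rev by (simp only:)
qed

lemma is_path_rev: "is_path G q \<Longrightarrow> is_path G (rev q)"
  by (simp add: is_path_def successively_adj_rev del: successively_rev)

lemma path_between_rev: "path_between G u q v \<Longrightarrow> path_between G v (rev q) u"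
  by (simp add: path_between_def is_path_rev hd_rev last_rev)

lemma is_path_Cons:
  "q \<noteq> [] \<Longrightarrow> is_path G (x # q) \<longleftrightarrow> is_path G q \<and> x \<notin> set q \<and> x \<in> verts G \<and> adj G x (hd q)"
  by (cases q) (auto simp: is_path_def)

lemma path_between_Cons:
  "path_between G y q v \<Longrightarrow> x \<notin> set q \<Longrightarrow> x \<in> verts G \<Longrightarrow> adj G x y \<Longrightarrow> path_between G x (x # q) v"
  by (auto simp: path_between_def is_path_Cons) (auto simp: is_path_def)

lemma path_between_suffix:
  assumes "path_between G u (a @ y # b) v"
  shows "path_between G y (y # b) v"
  using assms by (auto simp: path_between_def is_path_def successively_append_iff)

lemma path_between_prefix:
  assumes "path_between G u (a @ y # b) v"
  shows "path_between G u (a @ [y]) y"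
  using assms
  by (auto simp: path_between_def is_path_def successively_append_iff hd_append)

lemma path_between_single: "x \<in> verts G \<Longrightarrow> path_between G x [x] x"
  by (simp add: path_between_def is_path_def)

lemma path_between_loop:
  assumes "path_between G x q x"
  shows "q = [x]"
proof (rule ccontr)
  assume "q \<noteq> [x]"
  moreover from assms obtain q' where q: "q = x # q'"
    by (cases q) (auto simp: path_between_def is_path_def)
  ultimately have "q' \<noteq> []" by simp
  then have "x \<in> set q'" using assms q by (auto simp: path_between_def dest: last_in_set)
  then show False using assms q by (simp add: path_between_def is_path_def)
qed

text \<open>Where two paths to \<open>v\<close> leave \<open>u\<close> by different edges, following
  one until it first meets the other and returning along the other closes a cycle.\<close>

lemma path_unique:
  assumes acyc: "\<not> has_cycle G"
  shows "path_between G u q v \<Longrightarrow> path_between G u q' v \<Longrightarrow> q = q'"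
proof (induction q arbitrary: u q')
  case Nil
  then show ?case by (simp add: path_between_def is_path_def)
next
  case (Cons x q)
  have x: "x = u" using Cons.prems by (simp add: path_between_def)
  obtain s where q': "q' = u # s"
    using Cons.prems(2) by (cases q') (auto simp: path_between_def is_path_def)
  show ?case
  proof (cases "u = v")
    case True
    then show ?thesis using Cons.prems path_between_loop by metis
  next
    case False
    have ne: "q \<noteq> []" "s \<noteq> []" using False Cons.prems x q' by (auto simp: path_between_def)
    have sub: "path_between G (hd q) q v" "path_between G (hd s) s v"
      using Cons.prems ne unfolding x q' by (auto simp: path_between_def is_path_Cons)
    show ?thesis
    proof (cases "hd q = hd s")
      case True
      then show ?thesis using Cons.IH[of "hd q" s] sub x q' by simp
    next
      case neq: False
      have "\<exists>z\<in>set q. z \<in> set s"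
        using sub ne by (metis last_in_set path_between_def)
      then obtain a z b where q: "q = a @ z # b" "z \<in> set s" "\<forall>y\<in>set a. y \<notin> set s"
        using split_list_first_prop[of q "\<lambda>z. z \<in> set s"] by blast
      obtain a' b' where s: "s = a' @ z # b'" using split_list[OF q(2)] by blast
      let ?c = "u # a @ z # rev a'"
      have p1: "is_path G (u # a @ z # b)" "is_path G (u # a' @ z # b')"
        using Cons.prems x q q' s by (auto simp: path_between_def)
      have "successively (adj G) (rev (a' @ [z]))"
        using p1(2) unfolding successively_adj_rev
        by (auto simp: is_path_def successively_append_iff successively_Cons)
      then have "is_path G ?c"
        using p1 q s unfolding is_path_def
        by (auto simp: successively_append_iff successively_Cons hd_append)
      moreover have "adj G (last ?c) (hd ?c)"
        using p1(2) by (cases a') (auto simp: is_path_def adj_commute last_rev)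
      \<comment> \<open>If \<open>a\<close> and \<open>a'\<close> were both empty, \<open>z\<close>
        would head both \<open>q\<close> and \<open>s\<close>.\<close>
      moreover have "3 \<le> length ?c"
        using neq q s by (cases a; cases a') auto
      ultimately show ?thesis using acyc unfolding has_cycle_def by blast
    qed
  qed
qed

lemma tree_dist_eq:
  assumes "tree G" "path_between G u q v"
  shows "tree_dist G u v = length q - 1"
proof -
  have "(THE q. path_between G u q v) = q"
    using assms path_unique by (intro the_equality) (auto simp: tree_def)
  then show ?thesis by (simp add: tree_dist_def)
qed

lemma tree_path_exists:
  assumes "tree G" "u \<in> verts G" "v \<in> verts G"
  obtains q where "path_between G u q v"
  using assms unfolding tree_def connected_graph_def by blast

lemma tree_dist_commute:
  assumes "tree G" "u \<in> verts G" "v \<in> verts G"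
  shows "tree_dist G u v = tree_dist G v u"
proof -
  obtain q where q: "path_between G u q v" using tree_path_exists[OF assms] .
  then show ?thesis
    using tree_dist_eq[OF assms(1) q] tree_dist_eq[OF assms(1) path_between_rev[OF q]] by simp
qed

lemma path_reachable:
  assumes "is_path G q"
  shows "(\<lambda>x y. x \<in> verts G \<and> y \<in> verts G \<and> adj G x y)\<^sup>*\<^sup>* (hd q) (last q)"
  using assms
proof (induction q)
  case (Cons x q)
  show ?case
  proof (cases "q = []")
    case False
    then have q: "is_path G q" "x \<in> verts G" "hd q \<in> verts G" "adj G x (hd q)"
      using Cons.prems by (auto simp: is_path_Cons) (auto simp: is_path_def)
    then show ?thesis using Cons.IH False
      by (simp add: converse_rtranclp_into_rtranclp[where b = "hd q"])
  qed simp
qed (simp add: is_path_def)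

lemma reachable_path:
  assumes "(\<lambda>x y. x \<in> verts G \<and> y \<in> verts G \<and> adj G x y)\<^sup>*\<^sup>* u v" "u \<in> verts G"
  shows "\<exists>q. path_between G u q v"
  using assms
proof (induction rule: rtranclp_induct)
  case base
  then show ?case by (auto intro: exI[of _ "[u]"] simp: path_between_single)
next
  case (step y z)
  then obtain q where q: "path_between G u q y" by blast
  show ?case
  proof (cases "z \<in> set q")
    case True
    then obtain a b where "q = a @ z # b" using split_list by metis
    then show ?thesis using q path_between_prefix by metis
  next
    case False
    have "path_between G z (z # rev q) u"
      using path_between_Cons[OF path_between_rev[OF q]] step False by (simp add: adj_commute)
    then show ?thesis by (intro exI) (rule path_between_rev)
  qed
qed

lemma connected_iff_reachable:
  "connected_graph G \<longleftrightarrow> verts G \<noteq> {} \<and>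
    (\<forall>u\<in>verts G. \<forall>v\<in>verts G. (\<lambda>x y. x \<in> verts G \<and> y \<in> verts G \<and> adj G x y)\<^sup>*\<^sup>* u v)"
proof -
  have "(\<exists>q. path_between G u q v) \<longleftrightarrow>
      (\<lambda>x y. x \<in> verts G \<and> y \<in> verts G \<and> adj G x y)\<^sup>*\<^sup>* u v" if "u \<in> verts G" for u v
  proof
    assume "\<exists>q. path_between G u q v"
    then obtain q where "is_path G q" "hd q = u" "last q = v" by (auto simp: path_between_def)
    then show "(\<lambda>x y. x \<in> verts G \<and> y \<in> verts G \<and> adj G x y)\<^sup>*\<^sup>* u v"
      using path_reachable by blast
  qed (rule reachable_path[OF _ that])
  then show ?thesis unfolding connected_graph_def by blast
qed

lemma connected_induced_iff:
  "connected_graph (induced_subgraph G S) \<longleftrightarrow> S \<noteq> {} \<and>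
    (\<forall>u\<in>S. \<forall>v\<in>S. (\<lambda>x y. x \<in> S \<and> y \<in> S \<and> adj G x y)\<^sup>*\<^sup>* u v)"
proof -
  define H where "H = induced_subgraph G S"
  define R where "R = (\<lambda>x y. x \<in> verts H \<and> y \<in> verts H \<and> adj H x y)"
  have verts: "verts H = S" by (simp add: H_def induced_subgraph_def)
  have "R = (\<lambda>x y. x \<in> S \<and> y \<in> S \<and> adj G x y)"
    unfolding R_def verts by (intro ext) (auto simp: adj_def H_def induced_subgraph_def)
  moreover have "connected_graph H \<longleftrightarrow> verts H \<noteq> {} \<and> (\<forall>u\<in>verts H. \<forall>v\<in>verts H. R\<^sup>*\<^sup>* u v)"
    unfolding R_def by (rule connected_iff_reachable)
  ultimately show ?thesis unfolding H_def[symmetric] verts by metis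
qed

text \<open>A tree given by a parent function. Any \<open>rk\<close> decreasing towards the root is allowed, not only the depth;
  the value of \<open>p\<close> at the root is irrelevant.\<close>

locale rooted =
  fixes T :: "'a graph" and r :: 'a and p :: "'a \<Rightarrow> 'a" and rk :: "'a \<Rightarrow> nat"
  assumes finite_verts: "finite (verts T)"
    and root_in: "r \<in> verts T"
    and parent_in: "\<And>v. v \<in> verts T \<Longrightarrow> v \<noteq> r \<Longrightarrow> p v \<in> verts T"
    and rk_parent: "\<And>v. v \<in> verts T \<Longrightarrow> v \<noteq> r \<Longrightarrow> rk (p v) < rk v"
    and edges_eq: "edges T = {{v, p v} | v. v \<in> verts T \<and> v \<noteq> r}"

text \<open>The parent is the second vertex on the unique path to \<open>r\<close>, the rank is the
  length of that path.\<close>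

lemma tree_rooted:
  assumes T: "tree T" and r: "r \<in> verts T"
  shows "\<exists>p rk. rooted T r p rk"
proof -
  define P where "P v = (THE q. path_between T v q r)" for v
  have P: "path_between T v (P v) r" if v: "v \<in> verts T" for v
  proof -
    obtain q where q: "path_between T v q r" using tree_path_exists[OF T v r] .
    then have "P v = q" unfolding P_def using path_unique T
      by (intro the_equality) (auto simp: tree_def)
    then show ?thesis using q by simp
  qed
  have Puniq: "P v = q" if "path_between T v q r" for v q
    unfolding P_def using path_unique T that by (intro the_equality) (auto simp: tree_def)
  define p where "p v = hd (tl (P v))" for v
  have decomp: "P v = v # P (p v) \<and> p v \<in> verts T \<and> adj T v (p v)" if v: "v \<in> verts T" "v \<noteq> r" for v
  proof -
    obtain w q where q: "P v = v # w # q"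
    proof -
      obtain a where a: "P v = v # a"
        using P[OF v(1)] by (cases "P v") (auto simp: path_between_def is_path_def)
      then show ?thesis using that v P[OF v(1)] by (cases a) (auto simp: path_between_def)
    qed
    have "path_between T w (w # q) r" using P[OF v(1)] path_between_suffix[of T v "[v]" w q r] q by simp
    then have "P w = w # q" by (rule Puniq)
    then show ?thesis using q P[OF v(1)] by (auto simp: p_def path_between_def is_path_def)
  qed
  have simple: "finite (verts T)" "\<And>e. e \<in> edges T \<Longrightarrow> e \<subseteq> verts T \<and> card e = 2"
    using T by (auto simp: tree_def simple_graph_def)
  \<comment> \<open>If \<open>y\<close> lies on the path of \<open>x\<close>, uniqueness forces it
    to come right after \<open>x\<close>; otherwise the path of \<open>y\<close> is \<open>y\<close>
    followed by the path of \<open>x\<close>.\<close>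
  have edge: "\<exists>v. e = {v, p v} \<and> v \<in> verts T \<and> v \<noteq> r" if e: "e \<in> edges T" for e
  proof -
    obtain x y where xy: "e = {x, y}" "x \<noteq> y" using simple(2)[OF e] by (meson card_2_iff)
    then have V: "x \<in> verts T" "y \<in> verts T" using simple(2)[OF e] by auto
    have adj: "adj T x y" using xy e by (simp add: adj_def)
    show ?thesis
    proof (cases "y \<in> set (P x)")
      case True
      then obtain a b where ab: "P x = a @ y # b" using split_list by metis
      have x: "path_between T x (a @ y # b) r" using P[OF V(1)] ab by simp
      then have "a \<noteq> []" using xy by (auto simp: path_between_def)
      then have "x \<notin> set (y # b)"
        using x by (cases a) (auto simp: path_between_def is_path_def)
      then have Px: "P x = x # y # b"
        using path_between_Cons[OF path_between_suffix[OF x]] V adj by (intro Puniq) auto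
      moreover have "x \<noteq> r" using Px P[OF V(1)] path_between_loop[of T x "P x"] by auto
      ultimately show ?thesis using xy V by (intro exI[of _ x]) (auto simp: p_def)
    next
      case False
      have "P y = y # P x"
        using path_between_Cons[OF P[OF V(1)] False V(2)] adj by (intro Puniq) (simp add: adj_commute)
      moreover have "hd (P x) = x" using P[OF V(1)] by (simp add: path_between_def)
      moreover have "y \<noteq> r" using False P[OF V(1)]
        by (metis is_path_def last_in_set path_between_def)
      ultimately show ?thesis using xy V by (intro exI[of _ y]) (auto simp: p_def)
    qed
  qed
  have "rooted T r p (\<lambda>v. length (P v))"
  proof
    show "edges T = {{v, p v} |v. v \<in> verts T \<and> v \<noteq> r}"
      using edge decomp by (auto simp: adj_def)
    show "length (P (p v)) < length (P v)" if "v \<in> verts T" "v \<noteq> r" for v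
      using decomp[OF that] by (metis length_Cons lessI)
  qed (use simple r decomp in auto)
  then show ?thesis by blast
qed

context rooted
begin

abbreviation V :: "'a set" where "V \<equiv> verts T"

lemma adj_iff: "adj T x y \<longleftrightarrow> (x \<in> V \<and> x \<noteq> r \<and> y = p x) \<or> (y \<in> V \<and> y \<noteq> r \<and> x = p y)"
  by (auto simp: adj_def edges_eq doubleton_eq_iff)

definition up :: "'a \<Rightarrow> 'a \<Rightarrow> bool" where
  "up = (\<lambda>w v. w \<in> V \<and> w \<noteq> r \<and> v = p w)\<^sup>*\<^sup>*"

lemma up_refl [simp]: "up v v" by (simp add: up_def)

lemma up_trans: "up u v \<Longrightarrow> up v w \<Longrightarrow> up u w"
  unfolding up_def by (rule rtranclp_trans)

lemma up_parent: "v \<in> V \<Longrightarrow> v \<noteq> r \<Longrightarrow> up v (p v)"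
  unfolding up_def by (rule r_into_rtranclp) simp

lemma up_cases: "up w v \<Longrightarrow> w = v \<or> (w \<in> V \<and> w \<noteq> r \<and> up (p w) v)"
  unfolding up_def by (erule converse_rtranclpE) auto

lemma up_in: "up w v \<Longrightarrow> w \<in> V \<Longrightarrow> v \<in> V"
  unfolding up_def by (induction rule: rtranclp_induct) (auto simp: parent_in)

lemma up_rk: "up w v \<Longrightarrow> w = v \<or> rk v < rk w"
  unfolding up_def by (induction rule: rtranclp_induct) (auto dest: rk_parent)

lemma up_antisym: "up w v \<Longrightarrow> up v w \<Longrightarrow> w = v"
  using up_rk by (metis order.asym)

lemma up_root: "w \<in> V \<Longrightarrow> up w r"
proof (induction "rk w" arbitrary: w rule: less_induct)
  case less
  show ?case
  proof (cases "w = r")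
    case False
    then have "up (p w) r" using less parent_in rk_parent by blast
    then show ?thesis using up_trans up_parent less.prems False by blast
  qed simp
qed

lemma up_from_root: "up r v \<Longrightarrow> v = r"
  using up_cases by blast

lemma up_linear:
  assumes "up w u" "up w v"
  shows "up u v \<or> up v u"
  using assms
proof (induction "rk w" arbitrary: w rule: less_induct)
  case less
  show ?case
  proof (cases "w = u \<or> w = v")
    case False
    then have w: "w \<in> V" "w \<noteq> r" "up (p w) u" "up (p w) v"
      using up_cases less.prems by blast+
    then show ?thesis using less.hyps[OF rk_parent] by blast
  qed (use less.prems in auto)
qed

definition children :: "'a \<Rightarrow> 'a set" where
  "children v = {c \<in> V. c \<noteq> r \<and> p c = v}"

definition below :: "'a \<Rightarrow> 'a set" where
  "below v = {w \<in> V. up w v}"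

definition above :: "'a \<Rightarrow> 'a set" where
  "above w = {v. up w v}"

lemma finite_children [simp]: "finite (children v)"
  using finite_verts by (simp add: children_def)

lemma finite_below [simp]: "finite (below v)"
  using finite_verts by (simp add: below_def)

lemma below_subset: "below v \<subseteq> V"
  by (auto simp: below_def)

lemma above_subset: "w \<in> V \<Longrightarrow> above w \<subseteq> V"
  using up_in by (auto simp: above_def)

lemma above_step:
  assumes "w \<in> V" "w \<noteq> r"
  shows "above w = insert w (above (p w)) \<and> w \<notin> above (p w)"
proof
  show "above w = insert w (above (p w))"
    using up_cases[of w] up_trans[OF up_parent[OF assms]] unfolding above_def by auto
  show "w \<notin> above (p w)"
    using up_rk[of "p w" w] rk_parent[OF assms] unfolding above_def by auto
qed

lemma above_root: "above r = {r}"
  using up_from_root by (auto simp: above_def)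

lemma child_in_below: "c \<in> children v \<Longrightarrow> c \<in> below v"
  using up_parent by (auto simp: below_def children_def)

lemma up_child:
  assumes "up w v" "w \<noteq> v"
  shows "\<exists>c\<in>children v. up w c"
  using assms(1)[unfolded up_def] assms(2)
proof (induction rule: rtranclp_induct)
  case (step y z)
  then show ?case unfolding up_def children_def by auto
qed simp

lemma below_eq: "v \<in> V \<Longrightarrow> below v = insert v (\<Union>c\<in>children v. below c)"
  using up_child up_trans child_in_below by (fastforce simp: below_def)

lemma children_not_up:
  assumes "c \<in> children v" "d \<in> children v" "up c d"
  shows "c = d"
proof (rule ccontr)
  assume "c \<noteq> d"
  then have "up v d" using up_cases[OF assms(3)] assms(1) by (auto simp: children_def)
  then have "up v d" "up d v" using assms(2) child_in_below by (auto simp: below_def)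
  then have "v = d" by (rule up_antisym)
  then show False using assms(2) rk_parent[of d] by (auto simp: children_def)
qed

lemma below_children_disjoint:
  assumes "c \<in> children v" "d \<in> children v" "c \<noteq> d"
  shows "below c \<inter> below d = {}"
  using assms children_not_up up_linear by (auto simp: below_def) blast

lemma not_below_child: "c \<in> children v \<Longrightarrow> v \<notin> below c"
  using up_rk[of v c] rk_parent[of c] by (auto simp: below_def children_def)

lemma card_below: "v \<in> V \<Longrightarrow> card (below v) = Suc (\<Sum>c\<in>children v. card (below c))"
proof -
  assume v: "v \<in> V"
  have "card (\<Union>c\<in>children v. below c) = (\<Sum>c\<in>children v. card (below c))"
    using below_children_disjoint by (intro card_UN_disjoint) auto
  then show ?thesis using below_eq[OF v] not_below_child by (subst below_eq[OF v]) auto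
qed

text \<open>The subtrees with topmost vertex \<open>v\<close>.\<close>

definition down_sets :: "'a \<Rightarrow> 'a set set" where
  "down_sets v = {S. S \<subseteq> V \<and> v \<in> S \<and> (\<forall>w\<in>S - {v}. w \<noteq> r \<and> p w \<in> S)}"

lemma finite_down_sets [simp]: "finite (down_sets v)"
  by (rule finite_subset[of _ "Pow V"]) (auto simp: down_sets_def finite_verts)

lemma empty_not_down_set: "{} \<notin> down_sets v"
  by (simp add: down_sets_def)

lemma down_sets_below: "S \<in> down_sets v \<Longrightarrow> S \<subseteq> below v"
proof
  fix w assume S: "S \<in> down_sets v"
  show "w \<in> S \<Longrightarrow> w \<in> below v"
  proof (induction "rk w" arbitrary: w rule: less_induct)
    case less
    show ?case
    proof (cases "w = v")
      case False
      then have w: "w \<noteq> r" "p w \<in> S" "w \<in> V" using S less.prems by (auto simp: down_sets_def)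
      then have "up (p w) v" using less rk_parent by (auto simp: below_def)
      then show ?thesis using w up_parent up_trans by (auto simp: below_def)
    qed (use S in \<open>auto simp: down_sets_def below_def\<close>)
  qed
qed

lemma down_sets_up_closed:
  assumes S: "S \<in> down_sets v" and w: "w \<in> S" and "up w u" "up u v"
  shows "u \<in> S"
  using assms(3)[unfolded up_def] assms(4)
proof (induction rule: rtranclp_induct)
  case (step y z)
  then have "up y v" using up_parent up_trans by blast
  moreover have "y \<noteq> v" using step up_rk[of "p y" v] rk_parent[of y] by auto
  ultimately show ?case using S step by (auto simp: down_sets_def)
qed (use w in simp)

lemma down_sets_restrict:
  assumes S: "S \<in> down_sets v" and c: "c \<in> children v" "S \<inter> below c \<noteq> {}"
  shows "S \<inter> below c \<in> down_sets c"
proof -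
  have cv: "up c v" using c child_in_below by (auto simp: below_def)
  have "c \<in> S" using down_sets_up_closed[OF S] c cv by (auto simp: below_def)
  then have "c \<in> S \<inter> below c" using c by (auto simp: below_def children_def)
  moreover have "w \<noteq> r \<and> p w \<in> S \<inter> below c" if w: "w \<in> S" "w \<in> below c" "w \<noteq> c" for w
  proof -
    have "w \<noteq> v" using w not_below_child[OF c(1)] by auto
    then have "w \<noteq> r" "p w \<in> S" using S w by (auto simp: down_sets_def)
    moreover have "up (p w) c" using w up_cases[of w c] by (auto simp: below_def)
    ultimately show ?thesis using w parent_in by (auto simp: below_def)
  qed
  ultimately show ?thesis unfolding down_sets_def using below_subset by blast
qed

lemma down_sets_Union:
  assumes v: "v \<in> V" and f: "\<And>c. c \<in> children v \<Longrightarrow> f c = {} \<or> f c \<in> down_sets c"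
  shows "insert v (\<Union>c\<in>children v. f c) \<in> down_sets v"
proof -
  have fV: "f c \<subseteq> V" if "c \<in> children v" for c
    using f[OF that] by (auto simp: down_sets_def)
  have "w \<noteq> r \<and> p w \<in> insert v (\<Union>c\<in>children v. f c)" if c: "c \<in> children v" "w \<in> f c" for c w
  proof (cases "w = c")
    case True
    then show ?thesis using c by (auto simp: children_def)
  next
    case False
    then show ?thesis using f[OF c(1)] c by (auto simp: down_sets_def)
  qed
  then show ?thesis using fV v unfolding down_sets_def by blast
qed

text \<open>A subtree with top \<open>v\<close> is an independent choice, for each child
  \<open>c\<close>, of nothing or of a subtree with top \<open>c\<close>. This product is the
  recursion that \<open>max_val\<close> optimizes.\<close>

lemma card_down_sets:
  assumes v: "v \<in> V"
  shows "card (down_sets v) = (\<Prod>c\<in>children v. Suc (card (down_sets c)))"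
proof -
  let ?F = "PiE (children v) (\<lambda>c. insert {} (down_sets c))"
  let ?g = "\<lambda>f. insert v (\<Union>c\<in>children v. f c)"
  let ?h = "\<lambda>S. restrict (\<lambda>c. S \<inter> below c) (children v)"
  have "bij_betw ?g ?F (down_sets v)"
  proof (rule bij_betw_byWitness[where f' = ?h])
    show "\<forall>f\<in>?F. ?h (?g f) = f"
    proof (intro ballI)
      fix f assume f: "f \<in> ?F"
      have fb: "f c \<subseteq> below c" if "c \<in> children v" for c
        using f that down_sets_below by blast
      show "?h (?g f) = f"
      proof
        fix c
        show "?h (?g f) c = f c"
        proof (cases "c \<in> children v")
          case True
          have "f d \<inter> below c = {}" if "d \<in> children v" "d \<noteq> c" for d
            using fb[OF that(1)] below_children_disjoint[OF that(1) True that(2)] by blast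
          then have "?g f \<inter> below c = f c"
            using fb[OF True] not_below_child[OF True] True by auto
          then show ?thesis using True by simp
        next
          case False
          then show ?thesis using f by (auto simp: PiE_def extensional_def)
        qed
      qed
    qed
    show "\<forall>S\<in>down_sets v. ?g (?h S) = S"
    proof
      fix S assume S: "S \<in> down_sets v"
      have "v \<in> S" using S by (simp add: down_sets_def)
      then show "?g (?h S) = S" using down_sets_below[OF S] below_eq[OF v] by auto
    qed
    show "?g ` ?F \<subseteq> down_sets v"
      using down_sets_Union[OF v] by (auto simp: PiE_def Pi_def)
    show "?h ` down_sets v \<subseteq> ?F"
    proof
      fix R assume "R \<in> ?h ` down_sets v"
      then obtain S where S: "S \<in> down_sets v" "R = ?h S" by blast
      have "S \<inter> below c = {} \<or> S \<inter> below c \<in> down_sets c" if "c \<in> children v" for c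
        using down_sets_restrict[OF S(1) that] by blast
      then show "R \<in> ?F" unfolding S(2) by (intro restrict_PiE_iff[THEN iffD2]) blast
    qed
  qed
  then have "card (down_sets v) = card ?F" by (simp add: bij_betw_same_card)
  also have "\<dots> = (\<Prod>c\<in>children v. card (insert {} (down_sets c)))"
    by (simp add: card_PiE)
  also have "\<dots> = (\<Prod>c\<in>children v. Suc (card (down_sets c)))"
    by (intro prod.cong refl) (simp add: empty_not_down_set)
  finally show ?thesis .
qed

lemma cross_edge: "adj T x y \<Longrightarrow> x \<in> V \<Longrightarrow> y \<in> V \<Longrightarrow> x \<in> below z \<Longrightarrow> y \<notin> below z \<Longrightarrow> x = z \<and> y = p z \<and> z \<noteq> r"
  using up_cases[of x z] up_trans[of y x z] up_parent[of y] unfolding adj_iff below_def by auto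

lemma degree_eq: "v \<in> V \<Longrightarrow> degree T v = card (children v) + (if v = r then 0 else 1)"
proof -
  assume v: "v \<in> V"
  have "{w \<in> V. adj T v w} = children v \<union> (if v = r then {} else {p v})"
    using v parent_in by (auto simp: adj_iff children_def)
  moreover have "v \<noteq> r \<Longrightarrow> p v \<notin> children v"
    using v rk_parent[of v] rk_parent[of "p v"] by (auto simp: children_def)
  ultimately show ?thesis by (auto simp: degree_def)
qed

lemma sum_children: "(\<Sum>v\<in>V. card (children v)) = card V - 1"
proof -
  have "(\<Sum>v\<in>V. card (children v)) = card (\<Union>v\<in>V. children v)"
    using finite_verts by (intro card_UN_disjoint[symmetric]) (auto simp: children_def)
  also have "(\<Union>v\<in>V. children v) = V - {r}"
    using parent_in by (auto simp: children_def)
  finally show ?thesis using root_in by simp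
qed

text \<open>The handshake identity; it fixes the number of trailing entries 1 in the degree sequence
  of an extended rgood tree.\<close>

lemma sum_degrees: "(\<Sum>v\<in>V. degree T v) = 2 * (card V - 1)"
proof -
  have "(\<Sum>v\<in>V. degree T v) = (\<Sum>v\<in>V. card (children v)) + (\<Sum>v\<in>V. if v = r then 0 else 1)"
    by (simp add: degree_eq sum.distrib)
  also have "(\<Sum>v\<in>V. if v = r then 0 else 1 :: nat) = (\<Sum>v\<in>V - {r}. 1)"
    using finite_verts by (intro sum.mono_neutral_cong_right) auto
  also have "\<dots> = card V - 1" using root_in by simp
  finally show ?thesis by (simp add: sum_children)
qed

text \<open>The top of a subtree is its vertex of least rank. A walk inside the subtree from any
  other vertex \<open>w\<close> to it must leave \<open>below w\<close>, and the only exit is the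
  edge from \<open>w\<close> to \<open>p w\<close>.\<close>

lemma subtrees_eq: "subtrees T = (\<Union>v\<in>V. down_sets v)"
proof (intro equalityI subsetI)
  fix S assume "S \<in> subtrees T"
  then have S: "S \<noteq> {}" "S \<subseteq> V" "connected_graph (induced_subgraph T S)"
    by (auto simp: subtrees_def)
  have conn: "(\<lambda>x y. x \<in> S \<and> y \<in> S \<and> adj T x y)\<^sup>*\<^sup>* u v" if "u \<in> S" "v \<in> S" for u v
    using S(3) that unfolding connected_induced_iff by blast
  obtain t where t: "t \<in> S" "\<And>w. w \<in> S \<Longrightarrow> rk t \<le> rk w"
    using S(1) ex_has_least_nat[of "\<lambda>w. w \<in> S" _ rk] by blast
  have "w \<noteq> r \<and> p w \<in> S" if w: "w \<in> S" "w \<noteq> t" for w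
  proof -
    have nb: "t \<notin> below w" using up_rk[of t w] t(2)[of w] w by (auto simp: below_def)
    have wb: "w \<in> below w" using w S by (auto simp: below_def)
    show ?thesis
      using conn[OF w(1) t(1)] nb
    proof (induction rule: rtranclp_induct)
      case (step y z)
      show ?case
      proof (cases "y \<in> below w")
        case True
        then show ?thesis using cross_edge[of y z w] step S(2) by auto
      qed (use step in auto)
    qed (use wb in auto)
  qed
  then have "S \<in> down_sets t" using S t by (auto simp: down_sets_def)
  then show "S \<in> (\<Union>v\<in>V. down_sets v)" using t S by auto
next
  fix S assume "S \<in> (\<Union>v\<in>V. down_sets v)"
  then obtain t where t: "t \<in> V" "S \<in> down_sets t" by blast
  then have S: "S \<subseteq> V" "t \<in> S" "\<And>w. w \<in> S \<Longrightarrow> w \<noteq> t \<Longrightarrow> w \<noteq> r \<and> p w \<in> S"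
    by (auto simp: down_sets_def)
  let ?R = "\<lambda>x y. x \<in> S \<and> y \<in> S \<and> adj T x y"
  have "?R\<^sup>*\<^sup>* w t \<and> ?R\<^sup>*\<^sup>* t w" if "w \<in> S" for w
    using that
  proof (induction "rk w" arbitrary: w rule: less_induct)
    case less
    show ?case
    proof (cases "w = t")
      case False
      then have w: "w \<noteq> r" "p w \<in> S" "w \<in> V" using S less.prems by auto
      then have IH: "?R\<^sup>*\<^sup>* (p w) t" "?R\<^sup>*\<^sup>* t (p w)" using less rk_parent by blast+
      have R: "?R w (p w)" "?R (p w) w" using w less.prems by (auto simp: adj_iff)
      show ?thesis
        using converse_rtranclp_into_rtranclp[of ?R, OF R(1) IH(1)]
          rtranclp.rtrancl_into_rtrancl[of ?R, OF IH(2) R(2)] by blast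
    qed simp
  qed
  then have "?R\<^sup>*\<^sup>* u v" if "u \<in> S" "v \<in> S" for u v
    using that by (meson rtranclp_trans)
  then have "connected_graph (induced_subgraph T S)"
    unfolding connected_induced_iff using S by blast
  then show "S \<in> subtrees T" using S by (auto simp: subtrees_def)
qed

text \<open>Connectedness holds because the whole vertex set is a down set of the root. On a cycle,
  both neighbours of a vertex of greatest rank would be its parent.\<close>

lemma is_tree: "tree T"
proof -
  have card2: "card {v, p v} = 2" if "v \<in> V" "v \<noteq> r" for v
    using rk_parent[OF that] by (simp add: card_2_iff) (metis less_irrefl)
  then have "simple_graph T"
    unfolding simple_graph_def edges_eq using finite_verts parent_in by auto
  moreover have "V \<in> down_sets r" using parent_in root_in by (auto simp: down_sets_def)
  then have "V \<in> subtrees T" using root_in by (auto simp: subtrees_eq)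
  then have "connected_graph (induced_subgraph T V)" by (simp add: subtrees_def)
  moreover have "induced_subgraph T V = T"
    using \<open>simple_graph T\<close> by (cases T) (auto simp: induced_subgraph_def simple_graph_def)
  moreover have "\<not> has_cycle T"
  proof
    assume "has_cycle T"
    then obtain c where c: "is_path T c" "3 \<le> length c" "adj T (last c) (hd c)"
      by (auto simp: has_cycle_def)
    define L where "L = length c"
    obtain i where i: "i < L" "\<And>j. j < L \<Longrightarrow> rk (c ! j) \<le> rk (c ! i)"
    proof -
      have "Max (rk ` set c) \<in> rk ` set c" using c by (intro Max_in) auto
      then obtain v where v: "v \<in> set c" "rk v = Max (rk ` set c)" by (metis imageE)
      then obtain i where "i < L" "c ! i = v" by (auto simp: in_set_conv_nth L_def)
      moreover have "rk (c ! j) \<le> rk v" if "j < L" for j using that v by (auto simp: L_def)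
      ultimately show ?thesis using that by blast
    qed
    have adjn: "adj T (c ! j) (c ! Suc j)" if "Suc j < L" for j
      using c(1) that by (auto simp: is_path_def L_def successively_conv_nth)
    have adjl: "adj T (c ! (L - 1)) (c ! 0)"
      using c by (simp add: L_def last_conv_nth hd_conv_nth is_path_def)
    have par: "c ! j = p (c ! i)" if "j < L" "adj T (c ! i) (c ! j)" for j
    proof (rule ccontr)
      assume "c ! j \<noteq> p (c ! i)"
      then have "rk (c ! i) < rk (c ! j)" using that(2) rk_parent by (auto simp: adj_iff)
      then show False using i(2)[OF that(1)] by simp
    qed
    define a where "a = (if i = 0 then L - 1 else i - 1)"
    define b where "b = (if i = L - 1 then 0 else Suc i)"
    have ab: "a < L" "b < L" "a \<noteq> b" using i c by (auto simp: a_def b_def L_def)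
    have "adj T (c ! a) (c ! i)"
      using adjl adjn[of "i - 1"] i by (auto simp: a_def)
    moreover have "adj T (c ! i) (c ! b)"
      using adjl adjn[of i] i by (auto simp: b_def)
    ultimately have "c ! a = c ! b" using par ab by (metis adj_commute)
    then show False using ab c(1) by (simp add: is_path_def nth_eq_iff_index_eq L_def)
  qed
  ultimately show ?thesis by (simp add: tree_def)
qed

section \<open>Distances and subtree counts across an edge\<close>

lemma path_crosses:
  assumes "successively (adj T) q" "set q \<subseteq> V" "q \<noteq> []" "hd q \<in> below z" "last q \<notin> below z"
  shows "z \<in> set q \<and> p z \<in> set q \<and> z \<noteq> r"
  using assms
proof (induction q)
  case (Cons x q)
  show ?case
  proof (cases "q = []")
    case False
    then have "adj T x (hd q)" "hd q \<in> set q" "hd q \<in> V"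
      using Cons.prems by (auto simp: successively_Cons)
    show ?thesis
    proof (cases "hd q \<in> below z")
      case True
      then show ?thesis using Cons False by (auto simp: successively_Cons)
    next
      case out: False
      then have "x = z \<and> hd q = p z \<and> z \<noteq> r"
        using cross_edge[of x "hd q" z] \<open>adj T x (hd q)\<close> \<open>hd q \<in> V\<close> Cons.prems by auto
      then show ?thesis using \<open>hd q \<in> set q\<close> by auto
    qed
  qed (use Cons in auto)
qed simp

lemma tree_dist_below:
  assumes z: "z \<in> V" "z \<noteq> r" and w: "w \<in> below z"
  shows "tree_dist T w (p z) = Suc (tree_dist T w z)"
proof -
  have wV: "w \<in> V" using w by (simp add: below_def)
  have pz: "p z \<notin> below z" using up_rk[of "p z" z] rk_parent[OF z] by (auto simp: below_def)
  obtain q where q: "path_between T w q z" using tree_path_exists[OF is_tree wV z(1)] .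
  have "p z \<notin> set q"
  proof
    assume "p z \<in> set q"
    then obtain a b where ab: "q = a @ p z # b" using split_list by metis
    have pre: "path_between T w (a @ [p z]) (p z)" using path_between_prefix q ab by metis
    then have "z \<in> set (a @ [p z])"
      using path_crosses[of "a @ [p z]" z] w pz by (auto simp: path_between_def is_path_def)
    moreover have "p z \<noteq> z" using rk_parent[OF z] by auto
    ultimately have "z \<in> set a" by simp
    moreover have "b \<noteq> []" using q ab \<open>p z \<noteq> z\<close> by (auto simp: path_between_def)
    then have "z \<in> set b" using q ab last_in_set[of b] by (auto simp: path_between_def)
    ultimately show False using q ab by (auto simp: path_between_def is_path_def)
  qed
  then have "path_between T (p z) (p z # rev q) w"
    using path_between_Cons[OF path_between_rev[OF q]] z parent_in by (simp add: adj_iff)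
  then have "path_between T w (rev (p z # rev q)) (p z)" by (rule path_between_rev)
  then have "tree_dist T w (p z) = length q" using tree_dist_eq[OF is_tree] by fastforce
  moreover have "tree_dist T w z = length q - 1" using tree_dist_eq[OF is_tree q] .
  moreover have "q \<noteq> []" using q by (auto simp: path_between_def is_path_def)
  ultimately show ?thesis by (cases q) auto
qed

lemma tree_dist_not_below:
  assumes z: "z \<in> V" "z \<noteq> r" and w: "w \<in> V" "w \<notin> below z"
  shows "tree_dist T w z = Suc (tree_dist T w (p z))"
proof -
  have zz: "z \<in> below z" using z by (simp add: below_def)
  obtain q where q: "path_between T w q (p z)" using tree_path_exists[OF is_tree w(1) parent_in[OF z]] .
  have "z \<notin> set q"
  proof
    assume "z \<in> set q"
    then obtain a b where ab: "q = a @ z # b" using split_list by metis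
    have pre: "path_between T z (rev (a @ [z])) w" using path_between_rev path_between_prefix q ab by metis
    then have "p z \<in> set (a @ [z])"
      using path_crosses[of "rev (a @ [z])" z] w zz by (auto simp: path_between_def is_path_def)
    moreover have "p z \<noteq> z" using rk_parent[OF z] by auto
    ultimately have "p z \<in> set a" by simp
    moreover have "b \<noteq> []" using q ab \<open>p z \<noteq> z\<close> by (auto simp: path_between_def)
    then have "p z \<in> set b" using q ab last_in_set[of b] by (auto simp: path_between_def)
    ultimately show False using q ab by (auto simp: path_between_def is_path_def)
  qed
  then have "path_between T z (z # rev q) w"
    using path_between_Cons[OF path_between_rev[OF q]] z by (simp add: adj_iff)
  then have "path_between T w (rev (z # rev q)) z" by (rule path_between_rev)
  then have "tree_dist T w z = length q" using tree_dist_eq[OF is_tree] by fastforce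
  moreover have "tree_dist T w (p z) = length q - 1" using tree_dist_eq[OF is_tree q] .
  moreover have "q \<noteq> []" using q by (auto simp: path_between_def is_path_def)
  ultimately show ?thesis by (cases q) auto
qed

text \<open>Passing from \<open>p z\<close> to \<open>z\<close> brings the vertices of
  \<open>below z\<close> one step closer and takes all others one step further away.\<close>

lemma vertex_distance_parent:
  assumes z: "z \<in> V" "z \<noteq> r"
  shows "vertex_distance T (p z) + card (V - below z) = vertex_distance T z + card (below z)"
proof -
  have sum: "(\<Sum>w\<in>V. g w) = (\<Sum>w\<in>below z. g w) + (\<Sum>w\<in>V - below z. g w)" for g :: "'a \<Rightarrow> nat"
    using sum.subset_diff[OF below_subset finite_verts] by (simp add: add.commute)
  have vd: "vertex_distance T v = (\<Sum>w\<in>V. tree_dist T w v)" if "v \<in> V" for v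
    unfolding vertex_distance_def using tree_dist_commute[OF is_tree that] by simp
  have "(\<Sum>w\<in>below z. tree_dist T w (p z)) = (\<Sum>w\<in>below z. tree_dist T w z) + card (below z)"
    using tree_dist_below[OF z] by (simp add: sum_Suc)
  moreover have "(\<Sum>w\<in>V - below z. tree_dist T w z) = (\<Sum>w\<in>V - below z. tree_dist T w (p z)) + card (V - below z)"
    using tree_dist_not_below[OF z] by (simp add: sum_Suc)
  ultimately show ?thesis using vd[OF z(1)] vd[OF parent_in[OF z]] sum by simp
qed

lemma path_to_root: "w \<in> V \<Longrightarrow> \<exists>q. path_between T w q r \<and> set q = above w"
proof (induction "rk w" arbitrary: w rule: less_induct)
  case less
  show ?case
  proof (cases "w = r")
    case True
    then show ?thesis using path_between_single root_in above_root by (metis list.set(1,2))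
  next
    case False
    then obtain q where q: "path_between T (p w) q r" "set q = above (p w)"
      using less parent_in rk_parent by blast
    then have "path_between T w (w # q) r"
      using path_between_Cons[OF q(1)] above_step[OF less.prems False] less.prems False
      by (auto simp: adj_iff)
    then show ?thesis using q above_step[OF less.prems False] by (metis list.simps(15))
  qed
qed

lemma card_above: "w \<in> V \<Longrightarrow> card (above w) = Suc (tree_dist T w r)"
proof -
  assume "w \<in> V"
  then obtain q where q: "path_between T w q r" "set q = above w" using path_to_root by blast
  then have "card (above w) = length q" "q \<noteq> []"
    by (metis distinct_card is_path_def path_between_def)+
  then show ?thesis using tree_dist_eq[OF is_tree q(1)] by (cases q) auto
qed

lemma finite_subtrees: "finite (subtrees T)"
  using finite_verts by (simp add: subtrees_eq)

lemma num_subtrees_root: "num_subtrees T r = card (down_sets r)"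
proof -
  have "{S \<in> subtrees T. r \<in> S} = down_sets r"
    using root_in by (auto simp: subtrees_eq down_sets_def)
  then show ?thesis by (simp add: num_subtrees_def)
qed

text \<open>Subtrees containing both ends cancel; those containing \<open>z\<close> without
  \<open>p z\<close> are exactly those with top \<open>z\<close>.\<close>

lemma num_subtrees_parent:
  assumes z: "z \<in> V" "z \<noteq> r"
  shows "num_subtrees T z + card {S \<in> subtrees T. p z \<in> S \<and> z \<notin> S} =
    num_subtrees T (p z) + card (down_sets z)"
proof -
  let ?B = "{S \<in> subtrees T. p z \<in> S \<and> z \<in> S}"
  have pz: "p z \<notin> below z" using up_rk[of "p z" z] rk_parent[OF z] by (auto simp: below_def)
  have ds: "down_sets z = {S \<in> subtrees T. z \<in> S \<and> p z \<notin> S}"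
  proof (intro equalityI subsetI)
    fix S assume "S \<in> down_sets z"
    then show "S \<in> {S \<in> subtrees T. z \<in> S \<and> p z \<notin> S}"
      using z pz down_sets_below by (auto simp: subtrees_eq down_sets_def)
  qed (auto simp: subtrees_eq down_sets_def)
  have "num_subtrees T z = card (?B \<union> down_sets z)"
    unfolding num_subtrees_def ds by (rule arg_cong[where f = card]) auto
  also have "\<dots> = card ?B + card (down_sets z)"
    using finite_subtrees by (intro card_Un_disjoint) (auto simp: ds)
  finally have 1: "num_subtrees T z = card ?B + card (down_sets z)" .
  have "num_subtrees T (p z) = card (?B \<union> {S \<in> subtrees T. p z \<in> S \<and> z \<notin> S})"
    unfolding num_subtrees_def by (rule arg_cong[where f = card]) auto
  also have "\<dots> = card ?B + card {S \<in> subtrees T. p z \<in> S \<and> z \<notin> S}"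
    using finite_subtrees by (intro card_Un_disjoint) auto
  finally show ?thesis using 1 by simp
qed

end

section \<open>Counting bounds for the two components left by deleting an edge at the root\<close>

context rooted
begin

text \<open>By induction each child contributes at most its optimal factor. Missing children are
  padded by branches of order 0, whose factor is \<open>max_val q 0 = 1\<close>.\<close>

lemma max_val_bound:
  assumes q: "0 < q" and "v \<in> V" "\<And>u. u \<in> below v \<Longrightarrow> card (children u) \<le> q"
  shows "Suc (card (down_sets v)) \<le> max_val q (card (below v))"
  using assms(2,3)
proof (induction "card (below v)" arbitrary: v rule: less_induct)
  case less
  interpret kary q using q by unfold_locales
  have c: "c \<in> V \<and> below c \<subseteq> below v \<and> card (below c) < card (below v)" if "c \<in> children v" for c
  proof -
    have "below c \<subset> below v"
      using below_eq[OF less.prems(1)] that not_below_child[OF that] by auto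
    then show ?thesis using that by (auto simp: children_def intro: psubset_card_mono)
  qed
  have IH: "Suc (card (down_sets c)) \<le> G (card (below c))" if "c \<in> children v" for c
    using less.hyps[of c] c[OF that] less.prems(2) by blast
  let ?M = "image_mset (\<lambda>c. card (below c)) (mset_set (children v))"
  let ?N = "?M + replicate_mset (q - card (children v)) 0"
  have "v \<in> below v" using less.prems by (simp add: below_def)
  then have "size ?N = q" using less.prems(2)[of v] by simp
  then have "Suc (PG ?N) \<le> G (Suc (sum_mset ?N))" by (rule G_ge)
  also have "Suc (sum_mset ?N) = card (below v)"
    using card_below[OF less.prems(1)] by (simp add: sum_unfold_sum_mset)
  finally have "Suc (PG ?M) \<le> G (card (below v))" by simp
  moreover have "card (down_sets v) \<le> (\<Prod>c\<in>children v. G (card (below c)))"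
    unfolding card_down_sets[OF less.prems(1)] using IH by (intro prod_mono) auto
  moreover have "PG ?M = (\<Prod>c\<in>children v. G (card (below c)))"
    by (simp add: prod_unfold_prod_mset image_mset.compositionality comp_def)
  ultimately show ?case by linarith
qed

lemma above_down_set: "w \<in> V \<Longrightarrow> above w \<in> down_sets r"
proof -
  assume w: "w \<in> V"
  have "p v \<in> above w" if "v \<in> above w" "v \<noteq> r" for v
    using that up_in[OF _ w] up_parent[of v] up_trans unfolding above_def by blast
  then show ?thesis using above_subset[OF w] up_root[OF w] by (auto simp: down_sets_def above_def)
qed

text \<open>The paths from the root to the vertices outside \<open>below x\<close> are distinct
  subtrees avoiding \<open>x\<close>.\<close>

lemma card_outside_le:
  assumes x: "x \<in> V" "p x = r"
  shows "card (V - below x) \<le> card {S \<in> subtrees T. p x \<in> S \<and> x \<notin> S}"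
proof (rule card_inj_on_le[of above])
  show "inj_on above (V - below x)"
  proof (rule inj_onI)
    fix u v assume "above u = above v"
    then have "up u v" "up v u" by (auto simp: above_def)
    then show "u = v" by (rule up_antisym)
  qed
  show "above ` (V - below x) \<subseteq> {S \<in> subtrees T. p x \<in> S \<and> x \<notin> S}"
    using above_down_set root_in x up_root by (auto simp: subtrees_eq above_def below_def)
  show "finite {S \<in> subtrees T. p x \<in> S \<and> x \<notin> S}" using finite_subtrees by simp
qed

text \<open>The path from the root to \<open>w\<close> together with any set of children of
  \<open>w\<close> other than \<open>x\<close> is a subtree avoiding \<open>x\<close>. This serves
  for a vertex of maximum degree on the far side of the edge.\<close>

lemma power_children_le:
  assumes x: "x \<in> V" "p x = r" and w: "w \<in> V" "w \<notin> below x"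
  shows "2 ^ card (children w - {x}) \<le> card {S \<in> subtrees T. p x \<in> S \<and> x \<notin> S}"
proof -
  let ?C = "children w - {x}"
  have disj: "?C \<inter> above w = {}"
  proof -
    have "\<not> up w c" if "c \<in> children w" for c
      using up_rk[of w c] rk_parent[of c] that by (auto simp: children_def)
    then show ?thesis by (auto simp: above_def)
  qed
  have "card (Pow ?C) \<le> card {S \<in> subtrees T. p x \<in> S \<and> x \<notin> S}"
  proof (rule card_inj_on_le[of "\<lambda>X. above w \<union> X"])
    show "inj_on (\<lambda>X. above w \<union> X) (Pow ?C)"
      using disj by (intro inj_onI) blast
    show "(\<lambda>X. above w \<union> X) ` Pow ?C \<subseteq> {S \<in> subtrees T. p x \<in> S \<and> x \<notin> S}"
    proof
      fix S assume "S \<in> (\<lambda>X. above w \<union> X) ` Pow ?C"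
      then obtain X where X: "X \<subseteq> ?C" "S = above w \<union> X" by blast
      have "S \<in> down_sets r"
        using above_down_set[OF w(1)] X by (auto simp: down_sets_def children_def above_def)
      moreover have "r \<in> S" "x \<notin> S"
        using X w up_root by (auto simp: above_def below_def)
      ultimately show "S \<in> {S \<in> subtrees T. p x \<in> S \<and> x \<notin> S}"
        using root_in x by (auto simp: subtrees_eq)
    qed
    show "finite {S \<in> subtrees T. p x \<in> S \<and> x \<notin> S}" using finite_subtrees by simp
  qed
  then show ?thesis by (simp add: card_Pow)
qed

lemma card_down_sets_le: "v \<in> V \<Longrightarrow> card (down_sets v) \<le> 2 ^ (card (below v) - 1)"
proof -
  assume v: "v \<in> V"
  have "card (down_sets v) \<le> card (Pow (below v - {v}))"
  proof (rule card_inj_on_le[of "\<lambda>S. S - {v}"])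
    show "inj_on (\<lambda>S. S - {v}) (down_sets v)"
      by (rule inj_onI) (auto simp: down_sets_def)
    show "(\<lambda>S. S - {v}) ` down_sets v \<subseteq> Pow (below v - {v})"
      using down_sets_below by blast
  qed simp
  moreover have "v \<in> below v" using v by (simp add: below_def)
  ultimately show ?thesis by (simp add: card_Pow)
qed

end

section \<open>The component cut off between core and centroid\<close>

lemma degree_le_max: "simple_graph G \<Longrightarrow> v \<in> verts G \<Longrightarrow> degree G v \<le> max_degree G"
  unfolding max_degree_def simple_graph_def by (intro Max_ge) auto

lemma degree_max_attained:
  assumes "simple_graph G" "verts G \<noteq> {}"
  obtains v where "v \<in> verts G" "degree G v = max_degree G"
proof -
  have "max_degree G \<in> degree G ` verts G"
    unfolding max_degree_def using assms by (intro Max_in) (auto simp: simple_graph_def)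
  then show ?thesis using that by auto
qed

lemma tree_dist_self: "tree G \<Longrightarrow> v \<in> verts G \<Longrightarrow> tree_dist G v v = 0"
  using tree_dist_eq path_between_single by fastforce

lemma set_dist_attained:
  assumes "finite (verts G)" "A \<subseteq> verts G" "B \<subseteq> verts G" "A \<noteq> {}" "B \<noteq> {}"
  obtains x y where "x \<in> A" "y \<in> B" "set_dist G A B = tree_dist G x y"
    "\<And>u v. u \<in> A \<Longrightarrow> v \<in> B \<Longrightarrow> tree_dist G x y \<le> tree_dist G u v"
proof -
  let ?S = "{tree_dist G u v | u v. u \<in> A \<and> v \<in> B}"
  have eq: "?S = (\<lambda>(u, v). tree_dist G u v) ` (A \<times> B)" by auto
  have fin: "finite ?S" unfolding eq using assms finite_subset by blast
  have "Min ?S \<in> ?S" using fin assms by (intro Min_in) auto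
  then obtain x y where xy: "x \<in> A" "y \<in> B" "Min ?S = tree_dist G x y" by blast
  moreover have "tree_dist G x y \<le> tree_dist G u v" if "u \<in> A" "v \<in> B" for u v
    unfolding xy(3)[symmetric] using fin that by (intro Min_le) auto
  ultimately show ?thesis using that unfolding set_dist_def by blast
qed

lemma subtree_core_nonempty:
  assumes "finite (verts G)" "verts G \<noteq> {}"
  shows "subtree_core G \<noteq> {}"
proof -
  have "Max (num_subtrees G ` verts G) \<in> num_subtrees G ` verts G" using assms by (intro Max_in) auto
  then obtain v where "v \<in> verts G" "num_subtrees G v = Max (num_subtrees G ` verts G)" by auto
  moreover have "\<forall>w\<in>verts G. num_subtrees G w \<le> Max (num_subtrees G ` verts G)" using assms by auto
  ultimately show ?thesis unfolding subtree_core_def by force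
qed

lemma centroid_nonempty:
  assumes "finite (verts G)" "verts G \<noteq> {}"
  shows "centroid G \<noteq> {}"
proof -
  have "Min (vertex_distance G ` verts G) \<in> vertex_distance G ` verts G" using assms by (intro Min_in) auto
  then obtain v where "v \<in> verts G" "vertex_distance G v = Min (vertex_distance G ` verts G)" by auto
  moreover have "\<forall>w\<in>verts G. Min (vertex_distance G ` verts G) \<le> vertex_distance G w" using assms by auto
  ultimately show ?thesis unfolding centroid_def by force
qed

text \<open>Shaped for the minimality of \<open>n'\<close>: the first inequality makes an extended
  rgood tree of order \<open>m\<close> exist, the second makes it admissible, and the third yields
  the bound once \<open>m\<close> is replaced by \<open>n'\<close>.\<close>

lemma core_side:
  assumes T: "tree T" and pos: "0 < set_dist T (subtree_core T) (centroid T)"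
    and k: "2 \<le> max_degree T"
  shows "\<exists>m. max_degree T \<le> m \<and> order T + 2 \<le> max_val (max_degree T - 1) m + m \<and>
    2 * (m + set_dist T (subtree_core T) (centroid T) - 1) < order T"
proof -
  let ?k = "max_degree T" and ?n = "order T" and ?d = "set_dist T (subtree_core T) (centroid T)"
  have simple: "simple_graph T" using T by (simp add: tree_def)
  have fin: "finite (verts T)" "verts T \<noteq> {}"
    using T by (auto simp: tree_def simple_graph_def connected_graph_def)
  obtain x y where xy: "x \<in> subtree_core T" "y \<in> centroid T" "?d = tree_dist T x y"
    and min: "\<And>u v. u \<in> subtree_core T \<Longrightarrow> v \<in> centroid T \<Longrightarrow> ?d \<le> tree_dist T u v"
    using set_dist_attained[OF fin(1) _ _ subtree_core_nonempty[OF fin] centroid_nonempty[OF fin]]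
    unfolding subtree_core_def centroid_def by (metis (no_types, lifting) mem_Collect_eq subsetI)
  have xV: "x \<in> verts T" and yV: "y \<in> verts T"
    using xy by (auto simp: subtree_core_def centroid_def)
  have neq: "x \<noteq> y" using xy(3) pos tree_dist_self[OF T yV] by auto
  obtain x1 where x1: "x1 \<in> verts T" "adj T x x1" "x1 \<noteq> x" "tree_dist T x1 y = ?d - 1"
  proof -
    obtain p rk where "rooted T y p rk" using tree_rooted[OF T yV] by blast
    then interpret R: rooted T y p rk .
    have px: "p x \<in> verts T" using R.parent_in xV neq by blast
    have "card (R.above x) = Suc (card (R.above (p x)))"
      using R.above_step[OF xV neq] finite_subset[OF R.above_subset[OF px] fin(1)] by simp
    then have "tree_dist T (p x) y = ?d - 1"
      using R.card_above[OF xV] R.card_above[OF px] xy(3) by simp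
    moreover have "p x \<noteq> x" using R.rk_parent[OF xV neq] by auto
    ultimately show ?thesis using that px xV neq R.adj_iff by blast
  qed
  have x1_core: "x1 \<notin> subtree_core T" using min[OF _ xy(2), of x1] x1(4) pos by auto
  then have F_less: "num_subtrees T x1 < num_subtrees T x"
    using xy(1) x1(1) unfolding subtree_core_def
    by (smt (verit) mem_Collect_eq not_le_imp_less order_trans)
  \<comment> \<open>Re-rooted at \<open>x1\<close>, the component \<open>A\<close> is
    \<open>below x\<close>, and each of its vertices has a parent, hence at most
    \<open>max_degree T - 1\<close> children.\<close>
  obtain p rk where "rooted T x1 p rk" using tree_rooted[OF T x1(1)] by blast
  then interpret R: rooted T x1 p rk .
  have px: "p x = x1" using x1 by (auto simp: R.adj_iff)
  have x_child: "x \<in> R.children x1" using xV x1 px by (simp add: R.children_def)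
  define m where "m = card (R.below x)"
  define Z where "Z = card {S \<in> subtrees T. p x \<in> S \<and> x \<notin> S}"
  have m_pos: "0 < m" unfolding m_def using R.card_below[OF xV] by simp
  have "num_subtrees T x + Z = num_subtrees T x1 + card (R.down_sets x)"
    using R.num_subtrees_parent[OF xV] x1(3) px by (simp add: Z_def)
  then have Z_less: "Z < card (R.down_sets x)" using F_less by linarith
  have outside: "card (verts T - R.below x) = ?n - m" and "m \<le> ?n"
    unfolding m_def order_def using fin R.below_subset
    by (simp_all add: card_Diff_subset card_mono)
  then have "?n - m \<le> Z" using R.card_outside_le[OF xV px] by (simp add: Z_def)
  have "card (R.children u) \<le> ?k - 1" if u: "u \<in> R.below x" for u
  proof -
    have "u \<in> verts T" "u \<noteq> x1" using u R.below_subset R.not_below_child[OF x_child] by auto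
    then show ?thesis using R.degree_eq[of u] degree_le_max[OF simple, of u] by simp
  qed
  then have "Suc (card (R.down_sets x)) \<le> max_val (?k - 1) m"
    unfolding m_def using R.max_val_bound[of "?k - 1" x] xV k by simp
  \<comment> \<open>The 2 collects the strictness of \<open>Z_less\<close> and the
    \<open>Suc\<close> by which \<open>max_val\<close> exceeds the number of root subtrees.\<close>
  then have val: "?n + 2 \<le> max_val (?k - 1) m + m"
    using Z_less \<open>?n - m \<le> Z\<close> \<open>m \<le> ?n\<close> by linarith
  have "?k \<le> m"
  proof -
    obtain w where w: "w \<in> verts T" "degree T w = ?k" using degree_max_attained[OF simple fin(2)] .
    show ?thesis
    proof (cases "w \<in> R.below x")
      case True
      then have "w \<noteq> x1" using R.not_below_child[OF x_child] by auto
      then have "w \<notin> R.children w" using R.rk_parent[of w] by (auto simp: R.children_def)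
      then have "card (insert w (R.children w)) = ?k"
        using R.degree_eq[OF w(1)] w \<open>w \<noteq> x1\<close> by simp
      moreover have "insert w (R.children w) \<subseteq> R.below x"
        using True R.child_in_below[of _ w] R.up_trans[of _ w x] unfolding R.below_def by blast
      ultimately show ?thesis unfolding m_def using card_mono[OF R.finite_below] by metis
    next
      case False
      \<comment> \<open>If \<open>w = x1\<close>, it has \<open>?k\<close> children, one of them
        \<open>x\<close>; otherwise \<open>w\<close> has a parent, and \<open>x\<close> is not among
        its children.\<close>
      have "card (R.children w - {x}) = ?k - 1"
        using R.degree_eq[OF w(1)] w x_child px by (auto simp: R.children_def)
      then have "2 ^ (?k - 1) \<le> Z"
        using R.power_children_le[OF xV px w(1) False] by (simp add: Z_def)
      also have "Z < 2 ^ (m - 1)"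
        using Z_less R.card_down_sets_le[OF xV] by (simp add: m_def)
      finally have "?k - 1 < m - 1" using power_strict_increasing_iff[of "2 :: nat"] by simp
      then show ?thesis by linarith
    qed
  qed
  moreover have "2 * (m + ?d - 1) < ?n"
  \<comment> \<open>The vertex before \<open>y\<close> on the path from \<open>x\<close> is
    \<open>x\<close> itself if \<open>y = x1\<close>, and the parent of \<open>y\<close> otherwise;
    only in the second case does the path have inner vertices.\<close>
  proof (cases "y = x1")
    case True
    then have "?d = 1" using x1(4) tree_dist_self[OF T yV] pos by simp
    have "x \<notin> centroid T" using min[OF xy(1), of x] tree_dist_self[OF T xV] pos by auto
    then have "vertex_distance T x1 < vertex_distance T x"
      using xy(2) xV True unfolding centroid_def
      by (smt (verit) mem_Collect_eq not_le_imp_less order_trans)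
    then have "m < ?n - m"
      using R.vertex_distance_parent[OF xV] x1(3) px outside by (simp add: m_def)
    then show ?thesis using \<open>?d = 1\<close> by simp
  next
    case False
    have x_not: "\<not> R.up x y"
      using R.up_cases[of x y] R.up_from_root neq px False by auto
    have dist_py: "tree_dist T x y = Suc (tree_dist T x (p y))"
      using R.tree_dist_not_below[OF yV False xV] x_not by (simp add: R.below_def)
    have "p y \<notin> centroid T" using min[OF xy(1), of "p y"] dist_py xy(3) by auto
    then have "vertex_distance T y < vertex_distance T (p y)"
      using xy(2) R.parent_in[OF yV False] unfolding centroid_def
      by (smt (verit) mem_Collect_eq not_le_imp_less order_trans)
    then have less: "card (verts T - R.below y) < card (R.below y)"
      using R.vertex_distance_parent[OF yV False] by linarith
    \<comment> \<open>A vertex \<open>y\<close> of \<open>A\<close> would be one step further from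
      \<open>x1\<close> than from \<open>x\<close>.\<close>
    have y_not: "\<not> R.up y x"
    proof
      assume "R.up y x"
      then have "tree_dist T y x1 = Suc (tree_dist T y x)"
        using R.tree_dist_below[OF xV, of y] x1(3) px yV by (simp add: R.below_def)
      then show False
        using x1(4) xy(3) tree_dist_commute[OF T xV yV] tree_dist_commute[OF T x1(1) yV] by simp
    qed
    have sub: "R.below x \<union> (R.above y - {y}) \<subseteq> verts T - R.below y"
      using x_not y_not R.up_linear R.up_antisym R.below_subset R.above_subset[OF yV]
      by (auto simp: R.below_def R.above_def)
    have disj: "R.below x \<inter> (R.above y - {y}) = {}"
      using y_not R.up_trans by (auto simp: R.below_def R.above_def)
    have fin_above: "finite (R.above y)" using finite_subset[OF R.above_subset[OF yV] fin(1)] .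
    \<comment> \<open>\<open>R.above y\<close> consists of the path from \<open>x1\<close> to
      \<open>y\<close>; without \<open>y\<close> these are the \<open>?d - 1\<close> inner vertices
      of the path from \<open>x\<close> to \<open>y\<close>.\<close>
    have "card (R.above y) = ?d"
      using R.card_above[OF yV] x1(4) tree_dist_commute[OF T x1(1) yV] pos by simp
    then have "card (R.above y - {y}) = ?d - 1" by (simp add: R.above_def)
    then have "m + (?d - 1) = card (R.below x \<union> (R.above y - {y}))"
      using disj fin_above by (simp add: card_Un_disjoint m_def)
    also have "\<dots> \<le> card (verts T - R.below y)" using sub fin by (intro card_mono) auto
    finally have "m + (?d - 1) \<le> card (verts T - R.below y)" .
    moreover have "card (verts T - R.below y) + card (R.below y) = ?n"
      unfolding order_def using fin R.below_subset[of y]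
      by (simp add: card_Diff_subset card_mono)
    ultimately show ?thesis using less pos by linarith
  qed
  ultimately show ?thesis using val by blast
qed

section \<open>Greedy trees\<close>

context kary
begin

text \<open>In breadth-first numbering, the descendants of \<open>v\<close> that are \<open>l\<close> levels below it occupy the \<open>q ^ l\<close>
  numbers from \<open>q ^ l * v + csize l\<close> on; \<open>lev m l v\<close> counts those below \<open>m\<close>.\<close>

definition lev :: "nat \<Rightarrow> nat \<Rightarrow> nat \<Rightarrow> nat" where
  "lev m l v = min (q ^ l) (m - (q ^ l * v + csize l))"

text \<open>The order of the branch at \<open>v\<close> in the greedy tree of order
  \<open>m\<close>. Levels from \<open>m\<close> on are empty since
  \<open>m <= csize m\<close>.\<close>

definition hsize :: "nat \<Rightarrow> nat \<Rightarrow> nat" where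
  "hsize m v = (\<Sum>l<m. lev m l v)"

lemma sum_min_blocks: "(\<Sum>i<n. min B (M - i * B)) = min (n * B) (M :: nat)"
  by (induction n) (auto simp: min_def)

text \<open>The descendants \<open>l\<close> levels below the \<open>q\<close> children of
  \<open>v\<close> form \<open>q\<close> consecutive blocks of length \<open>q ^ l\<close>, and
  cutting at \<open>m\<close> is compatible with this division.\<close>

lemma lev_Suc: "lev m (Suc l) v = (\<Sum>i<q. lev m l (q * v + 1 + i))"
proof -
  have "q ^ l * (q * v + 1 + i) + csize l = q ^ Suc l * v + csize (Suc l) + i * q ^ l" for i
    by (simp add: csize_Suc algebra_simps)
  then show ?thesis
    using sum_min_blocks[of "q ^ l" "m - (q ^ Suc l * v + csize (Suc l))" q]
    unfolding lev_def by (simp only: diff_diff_left[symmetric]) simp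
qed

lemma lev_last: "lev m m v = 0"
  using le_csize[of m] by (simp add: lev_def)

lemma hsize_Suc: "hsize m v = (\<Sum>l<Suc m. lev m l v)"
  by (simp add: hsize_def lev_last)

lemma hsize_rec:
  assumes "v < m"
  shows "hsize m v = Suc (\<Sum>i<q. hsize m (q * v + 1 + i))"
proof -
  have "hsize m v = lev m 0 v + (\<Sum>l<m. lev m (Suc l) v)"
    unfolding hsize_Suc by (rule sum.lessThan_Suc_shift)
  also have "(\<Sum>l<m. lev m (Suc l) v) = (\<Sum>i<q. hsize m (q * v + 1 + i))"
    unfolding lev_Suc hsize_def by (rule sum.swap)
  finally show ?thesis using assms by (simp add: lev_def)
qed

lemma hsize_eq_0: "m \<le> v \<Longrightarrow> hsize m v = 0"
proof -
  assume v: "m \<le> v"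
  have "m \<le> q ^ l * v + csize l" for l
  proof -
    have "1 * v \<le> q ^ l * v" using q_pos by (intro mult_right_mono) auto
    then show ?thesis using v by linarith
  qed
  then show ?thesis by (simp add: hsize_def lev_def)
qed

lemma hsize_root: "hsize m 0 = m"
proof -
  have "(\<Sum>l<n. lev m l 0) = min m (csize n)" for n
    by (induction n) (auto simp: lev_def csize_Suc min_def)
  then show ?thesis using le_csize[of m] by (simp add: hsize_def)
qed

lemma hsize_full_levels:
  assumes "j \<le> m" "\<And>l. l < j \<Longrightarrow> lev m l v = q ^ l" "\<And>l. j < l \<Longrightarrow> lev m l v = 0"
  shows "hsize m v = csize j + lev m j v"
proof -
  have "hsize m v = (\<Sum>l<Suc j. lev m l v)"
    unfolding hsize_Suc using assms by (intro sum.mono_neutral_right) auto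
  also have "\<dots> = csize j + lev m j v"
    using assms(2) by (simp add: csize_def)
  finally show ?thesis .
qed

text \<open>\<open>w \<le> q * v\<close> says that all children of \<open>v\<close> come after \<open>w\<close> in breadth-first order.\<close>

lemma hsize_greedy_pair:
  assumes "v < w" "w \<le> q * v"
  shows "greedy_pair (hsize m w) (hsize m v)"
proof -
  \<comment> \<open>The first level on which the branch of \<open>w\<close> is incomplete. The
    branch of \<open>v\<close> comes earlier on each level, so it is complete wherever that of
    \<open>w\<close> is nonempty.\<close>
  define j where "j = (LEAST l. lev m l w < q ^ l)"
  have last: "lev m m w < q ^ m" using q_pos by (simp add: lev_last)
  have j: "lev m j w < q ^ j" unfolding j_def by (rule LeastI[where P = "\<lambda>l. lev m l w < q ^ l", OF last])
  have "j \<le> m" unfolding j_def by (rule Least_le[where P = "\<lambda>l. lev m l w < q ^ l", OF last])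
  have w_full: "lev m l w = q ^ l" if "l < j" for l
    using not_less_Least[of l "\<lambda>l. lev m l w < q ^ l"] that
    by (simp flip: j_def) (simp add: lev_def)
  have v_full: "lev m l v = q ^ l" if "0 < lev m l w" for l
  proof -
    have "q ^ l * Suc v \<le> q ^ l * w" using assms by (intro mult_left_mono) auto
    moreover have "q ^ l * w + csize l < m" using that by (auto simp: lev_def)
    ultimately have "q ^ l \<le> m - (q ^ l * v + csize l)" by simp
    then show ?thesis by (simp add: lev_def)
  qed
  \<comment> \<open>The numbering stops before the end of the block of \<open>w\<close> on level
    \<open>j\<close>, and \<open>w <= q * v\<close> places the next level below \<open>v\<close> no
    earlier than the numbers that remain; so neither branch has vertices beyond level
    \<open>j\<close>.\<close>
  have "m < q ^ j * Suc w + csize j" using j q_pos by (auto simp: lev_def min_def split: if_splits)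
  also have "\<dots> \<le> q ^ j * Suc (q * v) + csize j" using assms by (intro add_right_mono mult_left_mono) auto
  also have "\<dots> = q ^ Suc j * v + csize (Suc j)" by (simp add: csize_Suc algebra_simps)
  finally have end_j: "m \<le> q ^ Suc j * v + csize (Suc j)" by simp
  have zero: "lev m l u = 0" if "j < l" "v \<le> u" for l u
  proof -
    have "q ^ Suc j * v \<le> q ^ l * u"
      using that q_pos by (intro mult_mono power_increasing) auto
    moreover have "csize (Suc j) \<le> csize l" using that by (intro csize_mono) auto
    ultimately show ?thesis using end_j by (simp add: lev_def)
  qed
  have w: "hsize m w = csize j + lev m j w"
    using hsize_full_levels[OF \<open>j \<le> m\<close>] w_full zero assms by simp
  have v: "hsize m v = csize j + lev m j v"
    using hsize_full_levels[OF \<open>j \<le> m\<close>] w_full v_full zero q_pos by simp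
  have "lev m j v \<le> q ^ j" by (simp add: lev_def)
  then show ?thesis
    unfolding greedy_pair_def w v
    using v_full[of j] j by (intro exI[of _ j]) (cases "lev m j w = 0"; simp add: csize_Suc)
qed

lemma greedy_mset_image:
  assumes "finite A"
    and pair: "\<And>i j. i \<in> A \<Longrightarrow> j \<in> A \<Longrightarrow> i \<noteq> j \<Longrightarrow> f i \<le> f j \<Longrightarrow> greedy_pair (f i) (f j)"
  shows "greedy_mset (image_mset f (mset_set A))"
  unfolding greedy_mset_def
proof (intro allI impI, elim conjE)
  fix a b M assume ab: "image_mset f (mset_set A) = add_mset a (add_mset b M)" "a \<le> b"
  then obtain i N where i: "mset_set A = add_mset i N" "f i = a" "image_mset f N = add_mset b M"
    using msed_map_invR[OF ab(1)] by blast
  obtain j N' where j: "N = add_mset j N'" "f j = b"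
    using msed_map_invR[OF i(3)] by blast
  have A: "mset_set A = add_mset i (add_mset j N')" using i j by simp
  have "i \<in># mset_set A" "j \<in># mset_set A" unfolding A by simp_all
  then have "i \<in> A" "j \<in> A" using assms(1) by auto
  moreover have "i \<noteq> j"
  proof
    assume "i = j"
    then have "2 \<le> count (mset_set A) i" unfolding A by simp
    then show False using assms(1) \<open>i \<in> A\<close> by simp
  qed
  ultimately have "greedy_pair (f i) (f j)" using ab(2) by (intro pair) (simp_all add: i(2) j(2))
  then show "greedy_pair a b" by (simp add: i(2) j(2))
qed

lemma hsize_children_greedy:
  "greedy_mset (image_mset (\<lambda>i. hsize m (q * v + 1 + i)) (mset_set {..<q}))"
proof (rule greedy_mset_image)
  have pair: "greedy_pair (hsize m (q * v + 1 + j)) (hsize m (q * v + 1 + i))" if "i < j" "j < q" for i j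
  proof (rule hsize_greedy_pair)
    have "Suc v \<le> q * v + 1 + i" using q_pos by (cases q) auto
    have "q * v + 1 + j \<le> q * Suc v" using that by simp
    also have "\<dots> \<le> q * (q * v + 1 + i)"
      using \<open>Suc v \<le> q * v + 1 + i\<close> by (rule mult_left_mono) simp
    finally show "q * v + 1 + j \<le> q * (q * v + 1 + i)" .
  qed (use that in simp)
  fix i j
  assume ij: "i \<in> {..<q}" "j \<in> {..<q}" "i \<noteq> j" "hsize m (q * v + 1 + i) \<le> hsize m (q * v + 1 + j)"
  show "greedy_pair (hsize m (q * v + 1 + i)) (hsize m (q * v + 1 + j))"
  proof (cases "i < j")
    case True
    then have gp: "greedy_pair (hsize m (q * v + 1 + j)) (hsize m (q * v + 1 + i))" using pair ij by auto
    then have "hsize m (q * v + 1 + j) \<le> hsize m (q * v + 1 + i)" unfolding greedy_pair_def by blast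
    then show ?thesis using gp ij(4) by simp
  qed (use pair[of j i] ij in auto)
qed simp

lemma G_hsize:
  assumes "v < m"
  shows "G (hsize m v) = Suc (\<Prod>i<q. G (hsize m (q * v + 1 + i)))"
proof -
  let ?M = "image_mset (\<lambda>i. hsize m (q * v + 1 + i)) (mset_set {..<q})"
  have "hsize m v = Suc (sum_mset ?M)"
    unfolding hsize_rec[OF assms] sum_unfold_sum_mset ..
  moreover have "PG ?M = (\<Prod>i<q. G (hsize m (q * v + 1 + i)))"
    unfolding prod_unfold_prod_mset image_mset.compositionality comp_def ..
  ultimately show ?thesis using G_greedy[OF hsize_children_greedy[of m v]] by simp
qed

end

section \<open>Greedy trees as heaps\<close>

definition heap_parent :: "nat \<Rightarrow> nat \<Rightarrow> nat" where
  "heap_parent q v = (v - 1) div q"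

text \<open>The array layout of a \<open>q\<close>-ary heap: in breadth-first order every vertex
  gets \<open>q\<close> children as long as numbers last.\<close>

definition heap :: "nat \<Rightarrow> nat \<Rightarrow> nat graph" where
  "heap q m = \<lparr>verts = {..<m}, edges = {{v, heap_parent q v} | v. v \<in> {..<m} \<and> v \<noteq> 0}\<rparr>"

lemma verts_heap [simp]: "verts (heap q m) = {..<m}"
  by (simp add: heap_def)

lemma heap_parent_less: "0 < v \<Longrightarrow> heap_parent q v < v"
  unfolding heap_parent_def by (rule le_less_trans[OF div_le_dividend]) simp

lemma rooted_heap: "0 < m \<Longrightarrow> rooted (heap q m) 0 (heap_parent q) (\<lambda>v. v)"
  using heap_parent_less by unfold_locales (auto simp: heap_def intro: less_trans)

lemma heap_children:
  assumes "0 < q"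
  shows "{c. c < m \<and> c \<noteq> 0 \<and> heap_parent q c = v} = {q * v + 1..<min m (q * v + 1 + q)}"
proof -
  have iff: "heap_parent q c = v \<longleftrightarrow> q * v + 1 \<le> c \<and> c < q * v + 1 + q" if pos: "0 < c" for c
  proof -
    obtain n where c: "c = Suc n" using pos by (cases c) auto
    have "n div q = v \<longleftrightarrow> v \<le> n div q \<and> n div q < Suc v" by auto
    also have "\<dots> \<longleftrightarrow> v * q \<le> n \<and> n < Suc v * q"
      by (simp only: less_eq_div_iff_mult_less_eq[OF assms] div_less_iff_less_mult[OF assms])
    finally show ?thesis by (simp add: c heap_parent_def mult.commute add.commute)
  qed
  show ?thesis
  proof (intro set_eqI iffI)
    fix c
    assume "c \<in> {c. c < m \<and> c \<noteq> 0 \<and> heap_parent q c = v}"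
    then show "c \<in> {q * v + 1..<min m (q * v + 1 + q)}" using iff[of c] by simp
  next
    fix c
    assume "c \<in> {q * v + 1..<min m (q * v + 1 + q)}"
    then show "c \<in> {c. c < m \<and> c \<noteq> 0 \<and> heap_parent q c = v}" using iff[of c] by simp
  qed
qed

lemma card_heap_children:
  "0 < q \<Longrightarrow> card {c. c < m \<and> c \<noteq> 0 \<and> heap_parent q c = v} = min q (m - (q * v + 1))"
  by (subst heap_children) auto

lemma num_subtrees_heap:
  assumes "0 < q" "0 < m"
  shows "Suc (num_subtrees (heap q m) 0) = max_val q m"
proof -
  interpret kary q using assms by unfold_locales
  interpret H: rooted "heap q m" 0 "heap_parent q" "\<lambda>v. v" by (rule rooted_heap[OF assms(2)])
  have ch: "H.children v = {q * v + 1..<min m (q * v + 1 + q)}" for v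
    unfolding H.children_def heap_children[OF assms(1), symmetric] by auto
  have "Suc (card (H.down_sets v)) = G (hsize m v)" if "v < m" for v
    using that
  proof (induction "m - v" arbitrary: v rule: less_induct)
    case less
    have IH: "Suc (card (H.down_sets c)) = G (hsize m c)" if "c \<in> H.children v" for c
    proof -
      have "v < c" using that heap_parent_less[of c q] by (auto simp: H.children_def)
      then show ?thesis using less that by (auto simp: H.children_def)
    qed
    have "card (H.down_sets v) = (\<Prod>c\<in>H.children v. G (hsize m c))"
      using H.card_down_sets[of v] less.prems IH by simp
    \<comment> \<open>Numbers from \<open>m\<close> on stand for empty branches, with
      \<open>hsize\<close> 0 and factor 1.\<close>
    also have "\<dots> = (\<Prod>c\<in>{q * v + 1..<q * v + 1 + q}. G (hsize m c))"
      unfolding ch by (rule prod.mono_neutral_left) (auto simp: hsize_eq_0)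
    also have "\<dots> = (\<Prod>i<q. G (hsize m (q * v + 1 + i)))"
      using prod.shift_bounds_nat_ivl[of "\<lambda>c. G (hsize m c)" 0 "q * v + 1" q]
      by (simp add: add.commute atLeast0LessThan)
    finally show ?case using G_hsize[OF less.prems] by simp
  qed
  then show ?thesis using H.num_subtrees_root hsize_root assms(2) by simp
qed

lemma greedy_num_children_rgood:
  assumes ds: "ds = replicate a k @ [k - 1, s] @ replicate b 1" and i: "i < length ds"
  shows "greedy_num_children ds a i = (if i \<le> a then k - 1 else if i = Suc a then s - 1 else 0)"
proof -
  have d': "take a ds @ drop (Suc a) ds = replicate a k @ s # replicate b 1"
    by (simp add: ds)
  show ?thesis
    using i unfolding greedy_num_children_def d' Let_def
    by (cases i) (auto simp: ds nth_append nth_Cons split: nat.split)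
qed

text \<open>The root has degree \<open>k - 1\<close> but no parent, so it has \<open>k - 1\<close>
  children like the vertices of degree \<open>k\<close>; vertex \<open>Suc a\<close> takes the
  remaining \<open>s - 1\<close>. The length equation says that the blocks of children use up
  exactly the numbers below \<open>length ds\<close>.\<close>

lemma rooted_greedy_tree_heap:
  assumes ds: "ds = replicate a k @ [k - 1, s] @ replicate b 1"
    and s: "1 \<le> s" "s < k" and len: "length ds = (a + 1) * (k - 1) + s"
  shows "rooted_greedy_tree ds a = heap (k - 1) (length ds)"
proof -
  define q m where "q = k - 1" and "m = length ds"
  have q: "0 < q" "s \<le> q" using s by (auto simp: q_def)
  have m: "m = (a + 1) * q + s" using len by (simp add: q_def m_def)
  have fc: "greedy_first_child ds a i = min (q * i + 1) m" if "i \<le> m" for i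
    using that
  proof (induction i)
    case 0
    then show ?case using s m by (simp add: greedy_first_child_def)
  next
    case (Suc i)
    have "greedy_first_child ds a (Suc i) = greedy_first_child ds a i + greedy_num_children ds a i"
      by (simp add: greedy_first_child_def)
    also have "\<dots> = min (q * i + 1) m + (if i \<le> a then q else if i = Suc a then s - 1 else 0)"
      using Suc greedy_num_children_rgood[OF ds] by (simp add: q_def m_def)
    also have "\<dots> = min (q * Suc i + 1) m"
    proof -
      consider "i \<le> a" | "i = Suc a" | "Suc (Suc a) \<le> i" by linarith
      then show ?thesis
      proof cases
        case 1
        then obtain d where "a = i + d" using le_Suc_ex by blast
        then have "q * i + 1 \<le> m" "q * Suc i + 1 \<le> m" using m s by (simp_all add: algebra_simps)
        then show ?thesis using 1 by simp
      next
        case 2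
        then show ?thesis using m s q by (simp add: algebra_simps)
      next
        case 3
        then have "q * Suc (Suc a) \<le> q * i" by (intro mult_left_mono) auto
        then show ?thesis using 3 m q by (simp add: algebra_simps)
      qed
    qed
    finally show ?case .
  qed
  have child: "i < m \<and> greedy_first_child ds a i \<le> j \<and> j < greedy_first_child ds a (Suc i) \<longleftrightarrow>
      j < m \<and> j \<noteq> 0 \<and> heap_parent q j = i" for i j
  proof -
    have "j < m \<and> j \<noteq> 0 \<and> heap_parent q j = i \<longleftrightarrow> j \<in> {q * i + 1..<min m (q * i + 1 + q)}"
      using heap_children[OF q(1), of m i] by blast
    moreover have "j < m \<and> j \<noteq> 0 \<and> heap_parent q j = i \<Longrightarrow> i < m"
      using heap_parent_less[of j q] by linarith
    ultimately show ?thesis using fc[of i] fc[of "Suc i"] by (cases "i < m") (auto simp: algebra_simps)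
  qed
  have "{{i, j} | i j. i < m \<and> greedy_first_child ds a i \<le> j \<and> j < greedy_first_child ds a (Suc i)} =
      {{v, heap_parent q v} | v. v \<in> {..<m} \<and> v \<noteq> 0}"
    unfolding child by auto
  then show ?thesis unfolding rooted_greedy_tree_def heap_def by (simp add: q_def m_def)
qed

text \<open>Comparing the degree sum with twice the number of edges expresses \<open>b\<close>
  through \<open>a\<close>, \<open>k\<close> and \<open>s\<close>.\<close>

lemma rgood_length:
  assumes ds: "ds = replicate a k @ [k - 1, s] @ replicate b 1"
    and s: "1 \<le> s" "s < k" and "tree_degree_sequence ds"
  shows "length ds = (a + 1) * (k - 1) + s"
proof -
  obtain G :: "nat graph" where G: "tree G" "verts G = {..<length ds}" "\<And>i. i < length ds \<Longrightarrow> degree G i = ds ! i"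
    using assms(4) unfolding tree_degree_sequence_def by blast
  have "0 \<in> verts G" using G(2) ds by simp
  then obtain p rk where "rooted G 0 p rk" using tree_rooted[OF G(1)] by blast
  then interpret R: rooted G 0 p rk .
  have "sum_list ds = (\<Sum>i<length ds. ds ! i)" by (simp add: sum_list_sum_nth atLeast0LessThan)
  also have "\<dots> = 2 * (length ds - 1)" using R.sum_degrees G by simp
  finally have "a * k + (k - 1) + s + b = 2 * (a + 1 + b)" by (simp add: ds sum_list_replicate)
  moreover obtain q where "k = Suc q" using s by (cases k) auto
  ultimately show ?thesis by (simp add: ds algebra_simps)
qed

lemma sorted_wrt_replicate_ge: "sorted_wrt (\<ge>) (replicate n (x :: nat))"
  by (induction n) auto

text \<open>The sorted sequence prescribes the degree of vertex \<open>i\<close>, whereas the heap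
  has its root, of degree \<open>k - 1\<close>, at number 0. So the heap is relabelled.\<close>

lemma rgood_tree_degree_sequence:
  assumes ds: "ds = replicate a k @ [k - 1, s] @ replicate b 1"
    and s: "1 \<le> s" "s < k" and len: "length ds = (a + 1) * (k - 1) + s"
  shows "tree_degree_sequence ds"
proof -
  define q m where "q = k - 1" and "m = length ds"
  have q: "0 < q" "s \<le> q" "k = Suc q" using s by (auto simp: q_def)
  have m: "m = (a + 1) * q + s" using len by (simp add: q_def m_def)
  have am: "Suc a < m" by (simp add: m_def ds)
  \<comment> \<open>\<open>f\<close> moves the root from 0 to position \<open>a\<close>, behind the
    \<open>a\<close> vertices of degree \<open>k\<close>; its inverse \<open>g\<close> doubles as
    the rank.\<close>
  define f where "f v = (if v = 0 then a else if v \<le> a then v - 1 else v)" for v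
  define g where "g i = (if i = a then 0 else if i < a then Suc i else i)" for i
  define p where "p i = f (heap_parent q (g i))" for i
  define G where "G = \<lparr>verts = {..<m}, edges = {{i, p i} | i. i \<in> {..<m} \<and> i \<noteq> a}\<rparr>"
  have fg: "f (g i) = i" and gf: "g (f v) = v" for i v by (auto simp: f_def g_def)
  have fm: "f v < m" if "v < m" for v using that am by (auto simp: f_def)
  have gm: "g i < m" if "i < m" for i using that am by (auto simp: g_def)
  have g0: "g i = 0 \<longleftrightarrow> i = a" for i by (auto simp: g_def)
  interpret R: rooted G a p g
  proof
    fix v assume v: "v \<in> verts G" "v \<noteq> a"
    then have "heap_parent q (g v) < g v" using g0[of v] by (intro heap_parent_less) simp
    then show "g (p v) < g v" by (simp add: p_def gf)
    then show "p v \<in> verts G" using v gm[of v] fm[of "heap_parent q (g v)"] by (simp add: G_def p_def gf)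
  qed (use am in \<open>auto simp: G_def\<close>)
  have children: "R.children i = {c. c < m \<and> c \<noteq> a \<and> p c = i}" for i
    unfolding R.children_def by (simp add: G_def)
  have "card (R.children i) = min q (m - (q * g i + 1))" if i: "i < m" for i
  proof -
    have "bij_betw g (R.children i) {c. c < m \<and> c \<noteq> 0 \<and> heap_parent q c = g i}"
    proof (rule bij_betw_byWitness[where f' = f])
      show "g ` R.children i \<subseteq> {c. c < m \<and> c \<noteq> 0 \<and> heap_parent q c = g i}"
        unfolding children using gm g0 gf by (auto simp: p_def)
      show "f ` {c. c < m \<and> c \<noteq> 0 \<and> heap_parent q c = g i} \<subseteq> R.children i"
      proof
        fix i' assume "i' \<in> f ` {c. c < m \<and> c \<noteq> 0 \<and> heap_parent q c = g i}"
        then obtain c where c: "i' = f c" "c < m" "c \<noteq> 0" "heap_parent q c = g i" by blast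
        then have "f c \<noteq> a" using gf[of c] g0[of a] by auto
        then show "i' \<in> R.children i" unfolding children using c fm gf fg by (simp add: p_def)
      qed
    qed (use fg gf in auto)
    then show ?thesis using card_heap_children[OF q(1), of m "g i"] by (simp add: bij_betw_same_card)
  qed
  then have deg: "degree G i = min q (m - (q * g i + 1)) + (if i = a then 0 else 1)" if "i < m" for i
    using that R.degree_eq[of i] by (simp add: G_def)
  have "degree G i = ds ! i" if i: "i < m" for i
  proof -
    consider "i < a" | "i = a" | "i = Suc a" | "Suc (Suc a) \<le> i" by linarith
    then show ?thesis
    proof cases
      case 1
      then have "q * (i + 2) \<le> q * (a + 1)" by (intro mult_left_mono) auto
      then have "q \<le> m - (q * g i + 1)" using 1 m s by (simp add: g_def algebra_simps)
      then show ?thesis using 1 i deg[OF i] q by (simp add: ds nth_append)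
    next
      case 2
      have "q \<le> m - (q * g i + 1)" using 2 m s by (simp add: g_def algebra_simps)
      then show ?thesis using 2 i deg[OF i] q by (simp add: ds nth_append)
    next
      case 3
      have "m - (q * g i + 1) = s - 1" using 3 m by (simp add: g_def algebra_simps)
      then show ?thesis using 3 i deg[OF i] q s by (simp add: ds nth_append)
    next
      case 4
      then have "q * (a + 2) \<le> q * i" by (intro mult_left_mono) auto
      then have "m - (q * g i + 1) = 0" using 4 m q by (simp add: g_def algebra_simps)
      moreover have "ds ! i = 1" using 4 i by (auto simp: ds m_def nth_append nth_Cons split: nat.split)
      ultimately show ?thesis using 4 deg[OF i] by simp
    qed
  qed
  moreover have "sorted_wrt (\<ge>) ds"
    using s by (auto simp: ds sorted_wrt_append sorted_wrt_replicate_ge)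
  ultimately show ?thesis
    unfolding tree_degree_sequence_def using R.is_tree
    by (intro conjI exI[of _ G]) (auto simp: G_def m_def)
qed

lemma extended_rgood_treeD:
  assumes "extended_rgood_tree m k G u"
  shows "2 \<le> k \<and> k \<le> m \<and> G = heap (k - 1) m \<and> u = 0"
proof -
  obtain a s b where *: "1 \<le> s" "s < k" "length (replicate a k @ [k - 1, s] @ replicate b 1) = m"
    "tree_degree_sequence (replicate a k @ [k - 1, s] @ replicate b 1)"
    "G = rooted_greedy_tree (replicate a k @ [k - 1, s] @ replicate b 1) a" "u = 0"
    using assms unfolding extended_rgood_tree_def Let_def by blast
  note len = rgood_length[OF refl *(1,2,4)]
  have "m = (a + 1) * (k - 1) + s" using len *(3) by simp
  moreover have "1 * (k - 1) \<le> (a + 1) * (k - 1)" by (intro mult_right_mono) auto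
  ultimately have "k \<le> m" using * by linarith
  then show ?thesis using * rooted_greedy_tree_heap[OF refl *(1,2) len] by auto
qed

text \<open>Division of \<open>m - 1\<close> by \<open>k - 1\<close> yields the parameters:
  \<open>m - 1 = (a + 1) * (k - 1) + (s - 1)\<close>. With \<open>extended_rgood_treeD\<close>, each
  order \<open>m >= k\<close> has exactly one extended rgood tree.\<close>

lemma extended_rgood_tree_heap:
  assumes "2 \<le> k" "k \<le> m"
  shows "extended_rgood_tree m k (heap (k - 1) m) 0"
proof -
  define q where "q = k - 1"
  define a where "a = (m - 1) div q - 1"
  define s where "s = Suc ((m - 1) mod q)"
  define b where "b = m - a - 2"
  have q: "0 < q" "k = Suc q" using assms by (auto simp: q_def)
  have "0 < (m - 1) div q" using assms q by (simp add: div_greater_zero_iff)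
  then have "(a + 1) * q + (m - 1) mod q = m - 1" by (simp add: a_def)
  then have m: "m = (a + 1) * q + s" using assms by (simp add: s_def)
  have "1 \<le> s" "s < k" using q by (auto simp: s_def)
  have "(a + 1) * 1 \<le> (a + 1) * q" using q by (intro mult_left_mono) auto
  then have "a + 1 \<le> (a + 1) * q" by (simp only: mult_1_right)
  then have "a + 2 \<le> m" using m \<open>1 \<le> s\<close> by linarith
  let ?ds = "replicate a k @ [k - 1, s] @ replicate b 1"
  have len: "length ?ds = m" using \<open>a + 2 \<le> m\<close> by (simp add: b_def)
  have len': "length ?ds = (a + 1) * (k - 1) + s" using len m by (simp add: q_def)
  show ?thesis
    unfolding extended_rgood_tree_def Let_def
    using \<open>1 \<le> s\<close> \<open>s < k\<close> len rgood_tree_degree_sequence[OF refl _ _ len']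
      rooted_greedy_tree_heap[OF refl _ _ len']
    by (intro exI[of _ a] exI[of _ s] exI[of _ b]) auto
qed

section \<open>Greedy trees with a path attached to the root\<close>

definition attach_parent :: "nat \<Rightarrow> nat + nat \<Rightarrow> nat + nat" where
  "attach_parent q x =
     (case x of Inl v \<Rightarrow> Inl (heap_parent q v) | Inr i \<Rightarrow> if i \<le> 1 then Inl 0 else Inr (i - 1))"

lemma attach_parent_simps [simp]:
  "attach_parent q (Inl v) = Inl (heap_parent q v)"
  "attach_parent q (Inr (Suc 0)) = Inl 0"
  "attach_parent q (Inr (Suc (Suc i))) = Inr (Suc i)"
  by (simp_all add: attach_parent_def)

lemma attach_parent_Inr: "attach_parent q (Inr i) = (if i \<le> 1 then Inl 0 else Inr (i - 1))"
  by (simp add: attach_parent_def)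

lemma sum_image_iff: "Inr i \<in> Inr ` A \<longleftrightarrow> i \<in> A" "Inl i \<in> Inl ` B \<longleftrightarrow> i \<in> B"
  by auto

text \<open>\<open>q < m\<close> gives the root all its \<open>q\<close> children; with the path its
  degree is \<open>Suc q\<close>, the maximum.\<close>

locale rgood_with_path =
  fixes q m l :: nat
  assumes q_pos: "0 < q" and m_greater: "q < m" and l_pos: "0 < l"
begin

abbreviation T :: "(nat + nat) graph" where "T \<equiv> attach_path (heap q m) 0 l"

lemma verts_T: "verts T = Inl ` {..<m} \<union> Inr ` {1..l}"
proof -
  have "(\<lambda>i. if i = 0 then Inl 0 else Inr i) ` {..l} = insert (Inl 0) (Inr ` {1..l} :: (nat + nat) set)"
    by (force simp: image_iff)
  then show ?thesis using m_greater by (auto simp: attach_path_def Let_def)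
qed

lemma edges_T: "edges T = {{x, attach_parent q x} | x. x \<in> verts T \<and> x \<noteq> Inl 0}"
proof -
  have path: "{{if i = 0 then Inl 0 else Inr i, if Suc i = 0 then Inl 0 else Inr (Suc i)} | i. i < l} =
      {{Inr i, attach_parent q (Inr i)} | i. i \<in> {1..l}}" (is "?A = ?B")
  proof (intro equalityI subsetI)
    fix e assume "e \<in> ?A"
    then obtain i where i: "i < l" "e = {if i = 0 then Inl 0 else Inr i, Inr (Suc i)}" by auto
    then have "e = {Inr (Suc i), attach_parent q (Inr (Suc i))}" by (cases i) auto
    then show "e \<in> ?B" using i(1) by force
  next
    fix e assume "e \<in> ?B"
    then obtain i where i: "i \<in> {1..l}" "e = {Inr i, attach_parent q (Inr i)}" by auto
    then obtain j where j: "i = Suc j" by (cases i) auto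
    have "e = {if j = 0 then Inl 0 else Inr j, if Suc j = 0 then Inl 0 else Inr (Suc j)}"
      using i(2) j by (cases j) auto
    moreover have "j < l" using i(1) j by simp
    ultimately show "e \<in> ?A" by blast
  qed
  have heap: "(\<lambda>e. Inl ` e) ` edges (heap q m) =
      {{Inl v, attach_parent q (Inl v)} | v. v \<in> {..<m} \<and> v \<noteq> 0}" (is "?A = ?B")
  proof (intro equalityI subsetI)
    fix e assume "e \<in> ?A"
    then obtain v where "v \<in> {..<m}" "v \<noteq> 0" "e = Inl ` {v, heap_parent q v}"
      by (auto simp: heap_def)
    then show "e \<in> ?B" by auto
  next
    fix e assume "e \<in> ?B"
    then obtain v where v: "v \<in> {..<m}" "v \<noteq> 0" "e = Inl ` {v, heap_parent q v}" by auto
    then have "{v, heap_parent q v} \<in> edges (heap q m)" by (auto simp: heap_def)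
    then show "e \<in> ?A" using v(3) by blast
  qed
  have "edges T = {{Inl v, attach_parent q (Inl v)} | v. v \<in> {..<m} \<and> v \<noteq> 0} \<union>
      {{Inr i, attach_parent q (Inr i)} | i. i \<in> {1..l}}"
    unfolding heap[symmetric] path[symmetric] by (simp add: attach_path_def Let_def)
  also have "\<dots> = {{x, attach_parent q x} | x. x \<in> verts T \<and> x \<noteq> Inl 0}"
    unfolding verts_T by blast
  finally show ?thesis .
qed

sublocale R: rooted T "Inl 0" "attach_parent q" "case_sum (\<lambda>v. v) (\<lambda>i. i)"
proof
  fix x assume x: "x \<in> verts T" "x \<noteq> Inl 0"
  show "attach_parent q x \<in> verts T"
  proof (cases x)
    case (Inl v)
    then have "v < m" "0 < v" using x by (auto simp: verts_T)
    then have "heap_parent q v < m" using heap_parent_less less_trans by blast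
    then show ?thesis unfolding verts_T Inl attach_parent_simps by blast
  next
    case (Inr i)
    then have "i \<in> {1..l}" using x by (auto simp: verts_T)
    then have "i \<le> 1 \<or> i - 1 \<in> {1..l}" by auto
    moreover have "0 \<in> {..<m}" using m_greater by simp
    ultimately show ?thesis unfolding Inr attach_parent_Inr verts_T by auto
  qed
  show "case_sum (\<lambda>v. v) (\<lambda>i. i) (attach_parent q x) < case_sum (\<lambda>v. v) (\<lambda>i. i) x"
    using x heap_parent_less[of _ q] by (cases x) (auto simp: verts_T attach_parent_def)
next
  show "finite (verts T)" "Inl 0 \<in> verts T" using m_greater by (simp_all add: verts_T)
qed (rule edges_T)

lemma order_T: "order T = m + l"
proof -
  have "card (Inl ` {..<m} \<union> Inr ` {1..l} :: (nat + nat) set) = m + l"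
    by (subst card_Un_disjoint) (auto simp: card_image)
  then show ?thesis by (simp add: order_def verts_T)
qed

lemma children_Inl:
  "R.children (Inl v) = Inl ` {c. c < m \<and> c \<noteq> 0 \<and> heap_parent q c = v} \<union> (if v = 0 then {Inr 1} else {})"
  (is "_ = ?A")
proof (rule set_eqI)
  fix x
  show "x \<in> R.children (Inl v) \<longleftrightarrow> x \<in> ?A"
  proof (cases x)
    case (Inl c)
    have "x \<in> verts T \<longleftrightarrow> c < m" unfolding verts_T Inl by blast
    then show ?thesis by (auto simp: R.children_def Inl)
  next
    case (Inr i)
    have "x \<in> verts T \<longleftrightarrow> i \<in> {1..l}" unfolding verts_T Inr by blast
    then have "x \<in> R.children (Inl v) \<longleftrightarrow> i \<in> {1..l} \<and> i \<le> 1 \<and> v = 0"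
      unfolding R.children_def by (simp add: Inr attach_parent_Inr)
    moreover have "x \<in> ?A \<longleftrightarrow> v = 0 \<and> i = 1" by (auto simp: Inr)
    ultimately show ?thesis using l_pos by auto
  qed
qed

lemma children_Inr:
  assumes "1 \<le> i"
  shows "R.children (Inr i) = (if i < l then {Inr (Suc i)} else {})" (is "_ = ?A")
proof (rule set_eqI)
  fix x
  show "x \<in> R.children (Inr i) \<longleftrightarrow> x \<in> ?A"
  proof (cases x)
    case (Inl c)
    then show ?thesis by (simp add: R.children_def)
  next
    case (Inr j)
    have "x \<in> verts T \<longleftrightarrow> j \<in> {1..l}" unfolding verts_T Inr by blast
    then have "x \<in> R.children (Inr i) \<longleftrightarrow> j \<in> {1..l} \<and> \<not> j \<le> 1 \<and> j - 1 = i"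
      unfolding R.children_def by (simp add: Inr attach_parent_Inr)
    moreover have "x \<in> ?A \<longleftrightarrow> i < l \<and> j = Suc i" by (auto simp: Inr)
    ultimately show ?thesis using assms by auto
  qed
qed

lemma degree_Inl: "v < m \<Longrightarrow> degree T (Inl v) = Suc (min q (m - (q * v + 1)))"
proof -
  assume v: "v < m"
  let ?C = "{c. c < m \<and> c \<noteq> 0 \<and> heap_parent q c = v}"
  have "card (R.children (Inl v)) = card ?C + (if v = 0 then 1 else 0)"
  proof -
    have "finite (Inl ` ?C :: (nat + nat) set)" "Inr 1 \<notin> (Inl ` ?C :: (nat + nat) set)" by auto
    moreover have "card (Inl ` ?C :: (nat + nat) set) = card ?C" by (simp add: card_image)
    ultimately show ?thesis
      unfolding children_Inl by (cases "v = 0") (simp_all add: card_insert_disjoint)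
  qed
  moreover have "card ?C = min q (m - (q * v + 1))" by (rule card_heap_children[OF q_pos])
  ultimately show ?thesis using R.degree_eq[of "Inl v"] v by (simp add: verts_T)
qed

lemma degree_Inr: "i \<in> {1..l} \<Longrightarrow> degree T (Inr i) \<le> 2"
proof -
  assume i: "i \<in> {1..l}"
  then have "card (R.children (Inr i)) \<le> 1" by (simp add: children_Inr)
  moreover have "Inr i \<in> verts T" using i unfolding verts_T by blast
  ultimately show ?thesis using R.degree_eq[of "Inr i"] by simp
qed

lemma max_degree_T: "max_degree T = Suc q"
  unfolding max_degree_def
proof (rule Max_eqI)
  have "degree T (Inl 0) = Suc q" using degree_Inl[of 0] m_greater by simp
  then show "Suc q \<in> degree T ` verts T" using m_greater by (force simp: verts_T)
  fix d assume "d \<in> degree T ` verts T"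
  then obtain x where x: "x \<in> verts T" "d = degree T x" by blast
  show "d \<le> Suc q"
  proof (cases x)
    case (Inl v)
    then show ?thesis using x degree_Inl[of v] by (auto simp: verts_T)
  next
    case (Inr i)
    then show ?thesis using x degree_Inr[of i] q_pos by (auto simp: verts_T)
  qed
qed (use R.finite_verts in simp)

lemma Inr_down_below:
  "1 \<le> i \<Longrightarrow> i \<le> l \<Longrightarrow> card (R.down_sets (Inr i)) = Suc l - i \<and> card (R.below (Inr i)) = Suc l - i"
proof (induction "l - i" arbitrary: i)
  case 0
  then have i: "i = l" by simp
  then have "Inr i \<in> verts T" using l_pos by (auto simp: verts_T)
  then show ?case using R.card_down_sets[of "Inr i"] R.card_below[of "Inr i"] children_Inr[of i] 0 i by simp
next
  case (Suc d)
  then have "Inr i \<in> verts T" "i < l" by (auto simp: verts_T)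
  moreover have "R.children (Inr i) = {Inr (Suc i)}" using children_Inr Suc \<open>i < l\<close> by simp
  moreover have "card (R.down_sets (Inr (Suc i))) = l - i \<and> card (R.below (Inr (Suc i))) = l - i"
    using Suc.hyps(1)[of "Suc i"] Suc.hyps(2) \<open>i < l\<close> by simp
  ultimately have "card (R.down_sets (Inr i)) = Suc (l - i) \<and> card (R.below (Inr i)) = Suc (l - i)"
    using R.card_down_sets[of "Inr i"] R.card_below[of "Inr i"] by simp
  then show ?case using \<open>i < l\<close> by linarith
qed

lemma card_below_Inl:
  assumes "v < m" "v \<noteq> 0"
  shows "card (R.below (Inl v)) < m"
proof -
  have "\<not> R.up (Inr j) (Inl v)" for j
  proof (induction j rule: less_induct)
    case (less j)
    show ?case
    proof
      assume "R.up (Inr j) (Inl v)"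
      then have "Inr j \<in> verts T" and up: "R.up (attach_parent q (Inr j)) (Inl v)"
        using R.up_cases by blast+
      then have "1 \<le> j" by (auto simp: verts_T)
      then show False
        using up less[of "j - 1"] R.up_from_root[of "Inl v"] assms
        by (auto simp: attach_parent_Inr split: if_splits)
    qed
  qed
  moreover have "\<not> R.up (Inl 0) (Inl v)" using R.up_from_root[of "Inl v"] assms by auto
  ultimately have "R.below (Inl v) \<subseteq> Inl ` {1..<m}"
    using R.below_subset[of "Inl v"] unfolding R.below_def verts_T
    by (auto simp: image_iff) (metis Suc_leI not_gr_zero)
  then have "card (R.below (Inl v)) \<le> card (Inl ` {1..<m} :: (nat + nat) set)"
    by (intro card_mono) auto
  then show ?thesis using m_greater by (simp add: card_image)
qed

text \<open>Stepping from a path vertex towards the heap gains: the subtrees containing the parent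
  without the vertex are at least as many as the root subtrees of the heap, hence more than
  \<open>l\<close>, while at most \<open>l\<close> subtrees have the vertex as top.\<close>

lemma core_in_heap:
  assumes "l < num_subtrees (heap q m) 0"
  shows "subtree_core T \<subseteq> range Inl"
proof
  fix x assume x: "x \<in> subtree_core T"
  have "x \<noteq> Inr i" for i
  proof
    assume xi: "x = Inr i"
    then have i: "1 \<le> i" "i \<le> l" and V: "Inr i \<in> verts T"
      using x by (auto simp: subtree_core_def verts_T)
    let ?p = "attach_parent q (Inr i)"
    let ?Z = "{S \<in> subtrees T. ?p \<in> S \<and> Inr i \<notin> S}"
    interpret H: rooted "heap q m" 0 "heap_parent q" "\<lambda>v. v"
      by (rule rooted_heap) (use m_greater in simp)
    have "card (H.down_sets 0) \<le> card ?Z"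
    \<comment> \<open>A root subtree of the heap is extended by the path up to the parent of
      \<open>Inr i\<close>.\<close>
    proof (rule card_inj_on_le[of "\<lambda>S. Inl ` S \<union> Inr ` {1..<i}"])
      show "inj_on (\<lambda>S. Inl ` S \<union> Inr ` {1..<i}) (H.down_sets 0)"
        by (rule inj_onI) blast
      show "(\<lambda>S. Inl ` S \<union> Inr ` {1..<i}) ` H.down_sets 0 \<subseteq> ?Z"
      proof
        fix S' assume "S' \<in> (\<lambda>S. Inl ` S \<union> Inr ` {1..<i}) ` H.down_sets 0"
        then obtain S where S: "S \<in> H.down_sets 0" "S' = Inl ` S \<union> Inr ` {1..<i}" by blast
        have parent: "attach_parent q (Inr j) \<in> S'" if "j \<in> {1..i}" for j
          using S that by (auto simp: attach_parent_Inr sum_image_iff H.down_sets_def)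
        have "S' \<subseteq> verts T" "Inl 0 \<in> S'"
          using S i by (auto simp: H.down_sets_def verts_T)
        moreover have "w \<noteq> Inl 0 \<and> attach_parent q w \<in> S'" if w: "w \<in> S' - {Inl 0}" for w
        proof (cases w)
          case (Inl v)
          then show ?thesis using w S by (auto simp: H.down_sets_def)
        next
          case (Inr j)
          then show ?thesis using w S parent[of j] by auto
        qed
        ultimately have "S' \<in> R.down_sets (Inl 0)" by (simp add: R.down_sets_def)
        then have "S' \<in> subtrees T" using R.root_in by (auto simp: R.subtrees_eq)
        moreover have "?p \<in> S'" "Inr i \<notin> S'" using parent[of i] i S by auto
        ultimately show "S' \<in> ?Z" by simp
      qed
      show "finite ?Z" using R.finite_subtrees by simp
    qed
    then have "l < card ?Z" using assms H.num_subtrees_root by simp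
    moreover have "num_subtrees T (Inr i) + card ?Z = num_subtrees T ?p + (Suc l - i)"
      using R.num_subtrees_parent[OF V] Inr_down_below[OF i] by simp
    ultimately have "num_subtrees T (Inr i) < num_subtrees T ?p" using i by linarith
    moreover have "?p \<in> verts T" using R.parent_in[OF V] by simp
    ultimately show False using x xi by (auto simp: subtree_core_def)
  qed
  then show "x \<in> range Inl" by (cases x) auto
qed

text \<open>\<open>2 * m < m + l\<close> says that the heap has less than half of the vertices, so
  no vertex of the centroid lies in it. A path vertex with less than half of the tree up to and
  including it is beaten by its successor.\<close>

lemma centroid_on_path:
  assumes x: "x \<in> centroid T" and "2 * m < m + l"
  obtains i where "x = Inr i" "m + l \<le> 2 * (m + i)"
proof -
  have xV: "x \<in> verts T" and min: "\<And>w. w \<in> verts T \<Longrightarrow> vertex_distance T x \<le> vertex_distance T w"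
    using x by (auto simp: centroid_def)
  have outside: "card (verts T - R.below z) = m + l - card (R.below z)" for z
    using order_T R.below_subset[of z] R.finite_verts by (simp add: card_Diff_subset order_def)
  have path: "m + l \<le> 2 * (m + i)" if i: "x = (if i = 0 then Inl 0 else Inr i)" for i
  proof (rule ccontr)
    assume less: "\<not> m + l \<le> 2 * (m + i)"
    then have V: "Inr (Suc i) \<in> verts T" by (auto simp: verts_T)
    have p: "attach_parent q (Inr (Suc i)) = x" using i by (cases i) auto
    have "card (R.below (Inr (Suc i))) = l - i" using Inr_down_below[of "Suc i"] less by simp
    then have "vertex_distance T x + (m + l - (l - i)) = vertex_distance T (Inr (Suc i)) + (l - i)"
      using R.vertex_distance_parent[OF V] outside p by simp
    moreover have "m + l - (l - i) = m + i" "m + i < l - i" using less by simp_all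
    ultimately show False using min[OF V] by linarith
  qed
  show ?thesis
  proof (cases x)
    case (Inl v)
    have "v = 0"
    proof (rule ccontr)
      assume v: "v \<noteq> 0"
      have "v < m" using xV Inl by (auto simp: verts_T)
      then have "card (R.below x) < m" using card_below_Inl v Inl by blast
      moreover have "vertex_distance T (attach_parent q x) + (m + l - card (R.below x)) =
          vertex_distance T x + card (R.below x)"
        using R.vertex_distance_parent[OF xV] outside v Inl by simp
      moreover have "vertex_distance T x \<le> vertex_distance T (attach_parent q x)"
        using min R.parent_in[OF xV] v Inl by simp
      ultimately show False using assms(2) by linarith
    qed
    then show ?thesis using path[of 0] assms(2) Inl by simp
  next
    case (Inr i)
    then have "i \<noteq> 0" using xV by (auto simp: verts_T)
    then show ?thesis using path[of i] that Inr by simp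
  qed
qed

text \<open>The position on the attached part grows by at most one per step, which bounds distances
  from below without determining the path.\<close>

lemma path_height:
  assumes "is_path T w"
  shows "case_sum (\<lambda>_. 0) (\<lambda>i. i) (last w) \<le> case_sum (\<lambda>_. 0) (\<lambda>i. i) (hd w) + (length w - 1)"
  using assms
proof (induction w)
  case (Cons x w)
  show ?case
  proof (cases "w = []")
    case False
    then obtain y w' where w: "w = y # w'" by (cases w) auto
    have step: "case_sum (\<lambda>_. 0) (\<lambda>i. i) y \<le> Suc (case_sum (\<lambda>_. 0) (\<lambda>i. i) x)" if "adj T x y" for x y
      using that unfolding R.adj_iff by (cases x; cases y) (auto simp: attach_parent_def split: if_splits)
    have "adj T x (hd w)" "is_path T w" using Cons.prems False by (auto simp: is_path_Cons)
    then show ?thesis using Cons.IH step[of x "hd w"] by (simp add: w)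
  qed simp
qed (simp add: is_path_def)

lemma set_dist_ge:
  assumes "l < num_subtrees (heap q m) 0" "2 * m < m + l"
  shows "m + l \<le> 2 * (m + set_dist T (subtree_core T) (centroid T))"
proof -
  have fin: "finite (verts T)" "verts T \<noteq> {}" using R.finite_verts R.root_in by auto
  obtain x y where xy: "x \<in> subtree_core T" "y \<in> centroid T"
    "set_dist T (subtree_core T) (centroid T) = tree_dist T x y"
    using set_dist_attained[OF fin(1) _ _ subtree_core_nonempty[OF fin] centroid_nonempty[OF fin]]
    unfolding subtree_core_def centroid_def by (metis (no_types, lifting) mem_Collect_eq subsetI)
  obtain v where v: "x = Inl v" using core_in_heap[OF assms(1)] xy(1) by auto
  obtain i where i: "y = Inr i" "m + l \<le> 2 * (m + i)" using centroid_on_path[OF xy(2) assms(2)] .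
  have "x \<in> verts T" "y \<in> verts T" using xy by (auto simp: subtree_core_def centroid_def)
  then obtain w where w: "path_between T x w y" using tree_path_exists[OF R.is_tree] by blast
  then have "i \<le> length w - 1" using path_height[of w] v i by (auto simp: path_between_def)
  also have "\<dots> = tree_dist T x y" using tree_dist_eq[OF R.is_tree w] by simp
  finally show ?thesis using i(2) xy(3) by simp
qed

end

section \<open>The bound and its tightness\<close>

lemma ceiling_half: "\<lceil>(real n + 1) / 2\<rceil> = int (n div 2) + 1"
proof (rule ceiling_unique)
  have "n = 2 * (n div 2) \<or> n = 2 * (n div 2) + 1" by presburger
  then have "real n = 2 * real (n div 2) \<or> real n = 2 * real (n div 2) + 1" by linarith
  then show "of_int (int (n div 2) + 1) - 1 < (real n + 1) / 2" "(real n + 1) / 2 \<le> of_int (int (n div 2) + 1)"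
    by auto
qed

lemma admissible_heap:
  assumes "2 \<le> k" "k \<le> m" "n + 1 \<le> max_val (k - 1) m + m"
  shows "admissible_rgood_tree n k m (heap (k - 1) m) 0"
  using extended_rgood_tree_heap[OF assms(1,2)] num_subtrees_heap[of "k - 1" m] assms
  by (auto simp: admissible_rgood_tree_def order_def)

lemma min_rgood_order_ge: "is_min_rgood_order n k n' \<Longrightarrow> 2 \<le> k \<and> k \<le> n'"
  unfolding is_min_rgood_order_def admissible_rgood_tree_def using extended_rgood_treeD by blast

lemma core_centroid_dist_le:
  assumes min: "is_min_rgood_order n k n'" and T: "tree T" "order T = n" "max_degree T = k"
  shows "int (set_dist T (subtree_core T) (centroid T)) \<le> max 0 (int n - int n' - \<lceil>(real n + 1) / 2\<rceil> + 1)"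
proof (cases "set_dist T (subtree_core T) (centroid T) = 0")
  case False
  let ?d = "set_dist T (subtree_core T) (centroid T)"
  have k: "2 \<le> k" using min_rgood_order_ge[OF min] by simp
  obtain m where m: "k \<le> m" "n + 2 \<le> max_val (k - 1) m + m" "2 * (m + ?d - 1) < n"
    using core_side[OF T(1)] False k T by auto
  have "admissible_rgood_tree n k m (heap (k - 1) m) 0" using admissible_heap k m by simp
  then have "n' \<le> m" using min by (auto simp: is_min_rgood_order_def)
  moreover obtain e where "?d = Suc e" using False not0_implies_Suc by blast
  ultimately have "2 * (n' + ?d) < n + 2" using m(3) by simp
  then have "n' + ?d + n div 2 \<le> n" by presburger
  then show ?thesis unfolding ceiling_half by linarith
qed simp

theorem theorem3p16:
  fixes n k n' :: nat and bound :: int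
  assumes "n > 0" and "k > 0"
    and "is_min_rgood_order n k n'"
    and "bound = int n - int n' - \<lceil>(real n + 1) / 2\<rceil> + 1"
  shows "(\<forall>T :: 'a graph. tree T \<and> order T = n \<and> max_degree T = k \<longrightarrow>
            int (set_dist T (subtree_core T) (centroid T)) \<le> max 0 bound) \<and>
         (\<forall>G u. admissible_rgood_tree n k n' G u \<and> k < n \<and>
            \<not> (num_subtrees G u = n - n' \<and> bound > 0) \<longrightarrow>
            (let T = attach_path G u (n - n') in
               tree T \<and> order T = n \<and> max_degree T = k \<and>
               int (set_dist T (subtree_core T) (centroid T)) = max 0 bound))"
proof (intro conjI allI impI)
  fix T :: "'a graph"
  assume "tree T \<and> order T = n \<and> max_degree T = k"
  then show "int (set_dist T (subtree_core T) (centroid T)) \<le> max 0 bound"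
    using core_centroid_dist_le[OF assms(3)] assms(4) by blast
next
  fix G u
  assume asm: "admissible_rgood_tree n k n' G u \<and> k < n \<and> \<not> (num_subtrees G u = n - n' \<and> bound > 0)"
  have k: "2 \<le> k" "k \<le> n'" using min_rgood_order_ge[OF assms(3)] by auto
  have G: "G = heap (k - 1) n'" "u = 0"
    using asm extended_rgood_treeD unfolding admissible_rgood_tree_def by blast+
  have num: "int n - int n' \<le> int (num_subtrees G u)"
    using asm G by (simp add: admissible_rgood_tree_def order_def)
  \<comment> \<open>A heap of order \<open>n - 1 >= k\<close> is admissible, since it needs only one
    root subtree. So the attached path has at least one edge.\<close>
  have "n' < n"
  proof -
    interpret kary "k - 1" using k by unfold_locales simp
    have "max_val (k - 1) 0 < max_val (k - 1) (n - 1)" using asm k by (intro G_strict_mono) simp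
    then have "admissible_rgood_tree n k (n - 1) (heap (k - 1) (n - 1)) 0"
      using asm k by (intro admissible_heap) auto
    then have "n' \<le> n - 1" using assms(3) by (auto simp: is_min_rgood_order_def)
    then show ?thesis using asm by linarith
  qed
  interpret rgood_with_path "k - 1" n' "n - n'"
    using k \<open>n' < n\<close> by unfold_locales auto
  have T: "tree T" "order T = n" "max_degree T = k"
    using R.is_tree order_T max_degree_T \<open>n' < n\<close> k by simp_all
  have le: "int (set_dist T (subtree_core T) (centroid T)) \<le> max 0 bound"
    using core_centroid_dist_le[OF assms(3) T] assms(4) by simp
  \<comment> \<open>A positive bound means \<open>2 * n' < n\<close>, and the excluded equality
    makes the number of root subtrees strictly larger than the path length.\<close>
  have "bound \<le> int (set_dist T (subtree_core T) (centroid T))" if "0 < bound"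
  proof -
    have "2 * n' < n" using that unfolding assms(4) ceiling_half by presburger
    moreover have "n - n' < num_subtrees (heap (k - 1) n') 0"
      using num asm that G by auto
    ultimately have "n \<le> 2 * (n' + set_dist T (subtree_core T) (centroid T))"
      using set_dist_ge \<open>n' < n\<close> by simp
    then show ?thesis unfolding assms(4) ceiling_half by presburger
  qed
  then have "int (set_dist T (subtree_core T) (centroid T)) = max 0 bound" using le by linarith
  then show "let T = attach_path G u (n - n') in tree T \<and> order T = n \<and> max_degree T = k \<and>
      int (set_dist T (subtree_core T) (centroid T)) = max 0 bound"
    using T G by (simp add: Let_def)
qed

end
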